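(* $\mathrm{FO}(<,\lhd)$ is strictly less expressive than $\mathrm{FO}(\mathrm{Bit})$ on the class of all finite structures: every $\mathrm{FO}(<,\lhd)$-formula is equivalent on all finite structures to an $\mathrm{FO}(\mathrm{Bit})$-formula, but not conversely.
   Context: Built-in predicates: a $k$-ary numerical predicate $P\subseteq\mathbb{N}^k$ is interpreted on a finite structure with universe $[n]=\{0,\dots,n\}$ as $P^n=P\cap[n]^k$. For a list $\ell$ of such predicates, $\mathrm{FO}(\ell)$ is first-order logic over finite structures with universe $[n]$ (arbitrary $n$, arbitrary finite relational signature) that may additionally use symbols for the predicates in $\ell$, interpreted as $P^n$. $<$ is the usual order on $\mathbb{N}$ and $\mathrm{Bit}=\{(a,i)\in\mathbb{N}^2 : 2\nmid\lfloor a/2^i\rfloor\}$. Let $q_i=\frac{i(i+1)}{2}$; for $x\in\mathbb{N}$ let $c(x)=\max\{i: q_i\le x\}$ and $r(x)=x-q_{c(x)}$. The linear order $\lhd$ on $\mathbb{N}$: $x\lhd y$ iff $r(x)<r(y)$, or $r(x)=r(y)$ and $c(x)<c(y)$. *)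

theory Defs
  imports Main
begin

text \<open>Formulas over a finite relational signature (relation symbols are natural
numbers, each with an arity given by a function ar; a formula only mentions
finitely many of them), with equality and with atoms for built-in numerical
predicate symbols of type 'p.  Variables are natural numbers.\<close>

datatype 'p fo =
    Eq nat nat
  | Rel nat "nat list"
  | Num 'p "nat list"
  | Neg "'p fo"
  | Conj "'p fo" "'p fo"
  | Ex nat "'p fo"

fun wf :: "(nat \<Rightarrow> nat) \<Rightarrow> ('p \<Rightarrow> nat) \<Rightarrow> 'p fo \<Rightarrow> bool" where
  "wf ar pa (Eq x y) = True"
| "wf ar pa (Rel R xs) = (length xs = ar R)"
| "wf ar pa (Num P xs) = (length xs = pa P)"
| "wf ar pa (Neg \<phi>) = wf ar pa \<phi>"
| "wf ar pa (Conj \<phi> \<psi>) = (wf ar pa \<phi> \<and> wf ar pa \<psi>)"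
| "wf ar pa (Ex x \<phi>) = wf ar pa \<phi>"

text \<open>Semantics on a structure with universe [n] = {0..n}: I interprets the
relation symbols, pred gives the (infinite) numerical predicate P \<subseteq> \<nat>^k for
each built-in symbol; it is interpreted as P^n = P \<inter> [n]^k (the restriction is
automatic since assignments take values in [n]).\<close>

fun sat :: "('p \<Rightarrow> nat list set) \<Rightarrow> nat \<Rightarrow> (nat \<Rightarrow> nat list set) \<Rightarrow> 'p fo
             \<Rightarrow> (nat \<Rightarrow> nat) \<Rightarrow> bool" where
  "sat pred n I (Eq x y) \<sigma> = (\<sigma> x = \<sigma> y)"
| "sat pred n I (Rel R xs) \<sigma> = (map \<sigma> xs \<in> I R)"
| "sat pred n I (Num P xs) \<sigma> = (map \<sigma> xs \<in> pred P \<inter> {t. \<forall>a\<in>set t. a \<le> n})"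
| "sat pred n I (Neg \<phi>) \<sigma> = (\<not> sat pred n I \<phi> \<sigma>)"
| "sat pred n I (Conj \<phi> \<psi>) \<sigma> = (sat pred n I \<phi> \<sigma> \<and> sat pred n I \<psi> \<sigma>)"
| "sat pred n I (Ex x \<phi>) \<sigma> = (\<exists>a\<le>n. sat pred n I \<phi> (\<sigma>(x := a)))"

definition is_struct :: "(nat \<Rightarrow> nat) \<Rightarrow> nat \<Rightarrow> (nat \<Rightarrow> nat list set) \<Rightarrow> bool" where
  "is_struct ar n I \<longleftrightarrow>
     (\<forall>R. \<forall>t\<in>I R. length t = ar R \<and> (\<forall>a\<in>set t. a \<le> n))"

definition equiv_fo ::
  "(nat \<Rightarrow> nat) \<Rightarrow> ('p \<Rightarrow> nat list set) \<Rightarrow> 'p fo \<Rightarrow> ('q \<Rightarrow> nat list set) \<Rightarrow> 'q fo \<Rightarrow> bool" where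
  "equiv_fo ar pred1 \<phi> pred2 \<psi> \<longleftrightarrow>
     (\<forall>n I \<sigma>. is_struct ar n I \<longrightarrow> (\<forall>x. \<sigma> x \<le> n) \<longrightarrow>
        (sat pred1 n I \<phi> \<sigma> \<longleftrightarrow> sat pred2 n I \<psi> \<sigma>))"

definition q :: "nat \<Rightarrow> nat" where "q i = i * (i + 1) div 2"
definition cc :: "nat \<Rightarrow> nat" where "cc x = (GREATEST i. q i \<le> x)"
definition rr :: "nat \<Rightarrow> nat" where "rr x = x - q (cc x)"

definition tri_less :: "nat \<Rightarrow> nat \<Rightarrow> bool" where
  "tri_less x y \<longleftrightarrow> rr x < rr y \<or> (rr x = rr y \<and> cc x < cc y)"

definition Bit :: "nat \<Rightarrow> nat \<Rightarrow> bool" where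
  "Bit a i \<longleftrightarrow> \<not> (2 dvd (a div 2 ^ i))"

datatype sym_lt_tri = LessSym | TriSym

fun pred_lt_tri :: "sym_lt_tri \<Rightarrow> nat list set" where
  "pred_lt_tri LessSym = {[a, b] | a b. a < b}"
| "pred_lt_tri TriSym = {[a, b] | a b. tri_less a b}"

definition ar_lt_tri :: "sym_lt_tri \<Rightarrow> nat" where "ar_lt_tri s = 2"

datatype sym_bit = BitSym

fun pred_bit :: "sym_bit \<Rightarrow> nat list set" where
  "pred_bit BitSym = {[a, i] | a i. Bit a i}"

definition ar_bit :: "sym_bit \<Rightarrow> nat" where "ar_bit s = 2"

end

theory Submission
  imports Defs
begin

text \<open>
Reading a number as the set of its one bits, an element of \<open>[n]\<close> is an arbitrary subset of
\<open>{0..<log n}\<close>, so FO(Bit) can guess certificates of about \<open>log n\<close> bits.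

The order: numbers are compared lexicographically by their bits, which needs the order on the bit
positions, which in turn needs the order on the bit positions of bit positions. At this last level
the order is coded by the chain of its initial segments, which fits into a single element of \<open>[n]\<close>
and is recognised by the fact that it satisfies the lexicographic recursion.

The relation \<open>\<lhd>\<close>: by addition it suffices to define the triangular numbers, which are the products
\<open>a * b\<close> with \<open>b = 2 * a + 1\<close> or \<open>b + 1 = 2 * a\<close>. For multiplication cut the numbers into windows
of width \<open>W\<close>, a power of two near \<open>sqrt (log n)\<close>. If all windows of both factors use at most a
quarter of their bits, the product has no carries between windows, each of its windows is a
convolution sum, and the partial sums of such a sum fit into one element of \<open>[n]\<close>. The products of
single windows are sums of the same kind, and by distributivity four sparse summands of each factor
suffice. Guessing \<open>W\<close> subject to \<open>2 ^ (W * W) \<le> n\<close> is sound for every \<open>n\<close> and complete for large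
\<open>n\<close>, hence it remains to add the finitely many small triangular numbers by hand.

For the converse, let \<open>n + 1 = q m\<close>. Then \<open>[n]\<close> with \<open><\<close> and \<open>\<lhd>\<close> is the set of pairs
\<open>r \<le> c < m\<close> with the two lexicographic orders, so an Ehrenfeucht-Fraisse game on it is a game with
twice as many moves on the linear order \<open>m\<close>. Therefore FO(<, \<open>\<lhd>\<close>) cannot distinguish large \<open>m\<close>
from \<open>m + 1\<close>, and cannot define the parity of \<open>n\<close>.
\<close>

section \<open>Binary expansions and windows\<close>

lemma Bit_eq_bit: "Bit a i \<longleftrightarrow> bit a i"
  by (simp add: Bit_def bit_iff_odd)

lemma bit_imp_less: "bit (a::nat) i \<Longrightarrow> i < a"
proof -
  assume "bit a i"
  then have "a div 2 ^ i \<noteq> 0" by (auto simp: bit_iff_odd intro: ccontr)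
  then have "2 ^ i \<le> a" by (simp add: div_eq_0_iff not_less)
  then show "i < a" using less_exp[of i] by linarith
qed

lemma bit_imp_exp_le: "bit (a::nat) i \<Longrightarrow> 2 ^ i \<le> a"
  by (rule ccontr) (simp add: bit_iff_odd)

lemma bit_of_less_exp: "(a::nat) < 2 ^ k \<Longrightarrow> bit a i \<Longrightarrow> i < k"
  using bit_imp_exp_le[of a i] by (metis le_less_trans one_less_numeral_iff power_less_imp_less_exp semiring_norm(76))

text \<open>The highest position \<open>k\<close> at which the bits differ decides: the quotients by
  \<open>2 ^ Suc k\<close> agree, so those by \<open>2 ^ k\<close> differ by exactly one.\<close>

lemma nat_less_iff_bit:
  fixes a b :: nat
  shows "a < b \<longleftrightarrow> (\<exists>k. bit b k \<and> \<not> bit a k \<and> (\<forall>l>k. bit a l = bit b l))"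
    (is "_ \<longleftrightarrow> ?R a b")
proof -
  have R: "?R a b \<Longrightarrow> a < b" for a b :: nat
  proof -
    assume "?R a b"
    then obtain k where k: "bit b k" "\<not> bit a k" "\<forall>l>k. bit a l = bit b l" by blast
    have "drop_bit (Suc k) a = drop_bit (Suc k) b"
      by (rule bit_eqI) (use k(3) in \<open>auto simp: bit_drop_bit_eq\<close>)
    moreover have "drop_bit k a = 2 * drop_bit (Suc k) a"
      using k(2) by (simp add: drop_bit_eq_div bit_iff_odd div_mult2_eq[symmetric] mult.commute[of 2])
        (metis div_mult2_eq dvd_mult_div_cancel even_two_times_div_two mult.commute)
    moreover have "drop_bit k b = 2 * drop_bit (Suc k) b + 1"
      using k(1) by (simp add: drop_bit_eq_div bit_iff_odd mult.commute[of 2])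
        (metis div_mult2_eq odd_two_times_div_two_succ mult.commute Suc_eq_plus1)
    ultimately have "drop_bit k a < drop_bit k b" by simp
    then show "a < b" by (metis drop_bit_eq_div div_le_mono not_less)
  qed
  have "?R a b \<or> ?R b a" if "a \<noteq> b"
  proof -
    have fin: "finite {k. bit a k \<noteq> bit b k}"
      by (rule finite_subset[of _ "{..a + b}"]) (auto dest!: bit_imp_less)
    have ne: "{k. bit a k \<noteq> bit b k} \<noteq> {}"
      using that by (auto simp: bit_eq_iff)
    define k where "k = Max {k. bit a k \<noteq> bit b k}"
    have "bit a k \<noteq> bit b k" using Max_in[OF fin ne] by (simp add: k_def)
    moreover have "bit a l = bit b l" if "l > k" for l
      using Max_ge[OF fin, of l] that unfolding k_def by auto
    ultimately show ?thesis by metis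
  qed
  then show ?thesis using R by (metis less_asym' less_irrefl)
qed

lemma bit_comprehension:
  "\<exists>x::nat. x < 2 ^ L \<and> (\<forall>i. bit x i \<longleftrightarrow> i < L \<and> P i)"
proof (induction L arbitrary: P)
  case 0
  show ?case by (intro exI[of _ 0]) simp
next
  case (Suc L)
  from Suc[of "\<lambda>i. P (Suc i)"] obtain x :: nat
    where x: "x < 2 ^ L" "\<And>i. bit x i \<longleftrightarrow> i < L \<and> P (Suc i)" by blast
  have "bit (of_bool (P 0) + 2 * x) i \<longleftrightarrow> i < Suc L \<and> P i" for i
    by (cases i) (auto simp: x bit_0 bit_Suc)
  then show ?case using x(1)
    by (intro exI[of _ "of_bool (P 0) + 2 * x"]) auto
qed

section \<open>Binary addition\<close>

text \<open>Carry lookahead: a carry generated at \<open>j\<close> is propagated up to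
  \<open>i\<close>. Unlike the recursion \<open>carry_Suc\<close>, this is a first-order condition
  on bits and order.\<close>

definition carry :: "nat \<Rightarrow> nat \<Rightarrow> nat \<Rightarrow> bool" where
  "carry x y i \<longleftrightarrow> (\<exists>j<i. bit x j \<and> bit y j \<and> (\<forall>k. j < k \<and> k < i \<longrightarrow> bit x k \<or> bit y k))"

lemma carry_Suc: "carry x y (Suc i) \<longleftrightarrow> bit x i \<and> bit y i \<or> (bit x i \<or> bit y i) \<and> carry x y i"
  unfolding carry_def by (auto simp: less_Suc_eq)

lemma carry_iff: "carry x y i \<longleftrightarrow> 2 ^ i \<le> take_bit i x + take_bit i y"
proof (induction i)
  case 0
  show ?case by (simp add: carry_def)
next
  case (Suc i)
  have "take_bit i x < 2 ^ i" "take_bit i y < 2 ^ i" by simp_all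
  then show ?case
    unfolding carry_Suc Suc take_bit_Suc_from_most
    by (cases "bit x i"; cases "bit y i"; simp; linarith)
qed

lemma bit_add_carry:
  fixes x y :: nat
  shows "bit (x + y) i \<longleftrightarrow> (bit x i \<noteq> (bit y i \<noteq> carry x y i))"
proof -
  define X Y x0 y0 where d: "X = x div 2 ^ i" "Y = y div 2 ^ i" "x0 = x mod 2 ^ i" "y0 = y mod 2 ^ i"
  have b: "x0 < 2 ^ i" "y0 < 2 ^ i" by (simp_all add: d)
  have "(x0 + y0) div 2 ^ i = of_bool (2 ^ i \<le> x0 + y0)"
    using b by (auto simp: div_nat_eqI not_le)
  moreover have "x + y = (x0 + y0) + (X + Y) * 2 ^ i"
    by (simp add: d algebra_simps)
  ultimately have "(x + y) div 2 ^ i = X + Y + of_bool (2 ^ i \<le> x0 + y0)"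
    by simp
  then show ?thesis
    by (auto simp: bit_iff_odd carry_iff take_bit_eq_mod d)
qed

section \<open>Digits in base \<open>2 ^ W\<close>\<close>

definition win :: "nat \<Rightarrow> nat \<Rightarrow> nat \<Rightarrow> nat" where
  "win W p x = take_bit W (drop_bit p x)"

lemma bit_win: "bit (win W p x) i \<longleftrightarrow> i < W \<and> bit x (i + p)"
  by (simp add: win_def bit_take_bit_iff bit_drop_bit_eq add.commute)

lemma win_less [simp]: "win W p x < 2 ^ W"
  by (simp add: win_def)

lemma win_le: "win W p x \<le> x"
  unfolding win_def take_bit_eq_mod drop_bit_eq_div
  by (meson div_le_dividend le_trans mod_less_eq_dividend)

lemma win_eq_0: "x < 2 ^ p \<Longrightarrow> win W p x = 0"
  by (simp add: win_def drop_bit_eq_div)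

lemma win_add: "win W (p + p') x = win W p (drop_bit p' x)"
  by (simp add: win_def)

text \<open>The \<open>s i\<close> are base \<open>2 ^ W\<close> digits that may exceed
  \<open>2 ^ W\<close>, as convolution sums can in \<open>mult_eq_enc_conv\<close>.\<close>

definition enc :: "nat \<Rightarrow> nat \<Rightarrow> (nat \<Rightarrow> nat) \<Rightarrow> nat" where
  "enc W N s = (\<Sum>i<N. s i * 2 ^ (i * W))"

lemma enc_Suc: "enc W (Suc N) s = s 0 + 2 ^ W * enc W N (\<lambda>i. s (Suc i))"
  by (simp add: enc_def sum.lessThan_Suc_shift sum_distrib_left power_add ac_simps del: sum.lessThan_Suc)

lemma enc_win: "(\<And>i. i < N \<Longrightarrow> s i < 2 ^ W) \<Longrightarrow> win W (i * W) (enc W N s) = (if i < N then s i else 0)"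
proof (induction N arbitrary: i s)
  case 0
  show ?case by (simp add: enc_def win_def)
next
  case (Suc N)
  show ?case
  proof (cases i)
    case 0
    then show ?thesis using Suc.prems[of 0]
      by (simp add: enc_Suc win_def take_bit_eq_mod)
  next
    case (Suc j)
    have "win W (i * W) (enc W (Suc N) s) = win W (j * W) (drop_bit W (enc W (Suc N) s))"
      using win_add[of W "j * W" W] by (simp add: Suc add.commute)
    also have "drop_bit W (enc W (Suc N) s) = enc W N (\<lambda>i. s (Suc i))"
      using Suc.prems[of 0] by (simp add: enc_Suc drop_bit_eq_div)
    finally show ?thesis using Suc.IH[of "\<lambda>i. s (Suc i)" j] Suc.prems by (simp add: Suc)
  qed
qed

lemma enc_less: "(\<And>i. i < N \<Longrightarrow> s i < 2 ^ W) \<Longrightarrow> enc W N s < 2 ^ (N * W)"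
proof (induction N arbitrary: s)
  case 0
  show ?case by (simp add: enc_def)
next
  case (Suc N)
  have "enc W N (\<lambda>i. s (Suc i)) + 1 \<le> 2 ^ (N * W)" using Suc by (simp add: Suc_le_eq)
  then have "2 ^ W * (enc W N (\<lambda>i. s (Suc i)) + 1) \<le> 2 ^ W * 2 ^ (N * W)" by (rule mult_le_mono2)
  then show ?case using Suc.prems[of 0] by (simp add: enc_Suc power_add)
qed

lemma enc_of_win: "x < 2 ^ (N * W) \<Longrightarrow> x = enc W N (\<lambda>i. win W (i * W) x)"
proof (induction N arbitrary: x)
  case 0
  then show ?case by (simp add: enc_def)
next
  case (Suc N)
  have "x div 2 ^ W < 2 ^ (N * W)"
    using Suc.prems by (simp add: power_add less_mult_imp_div_less mult.commute)
  from Suc.IH[OF this] have "x div 2 ^ W = enc W N (\<lambda>i. win W (i * W + W) x)"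
    unfolding win_add by (simp add: drop_bit_eq_div)
  then have "enc W (Suc N) (\<lambda>i. win W (i * W) x) = x mod 2 ^ W + 2 ^ W * (x div 2 ^ W)"
    by (simp add: enc_Suc win_def take_bit_eq_mod add.commute)
  then show ?case by simp
qed

lemma sum_bits: "x < 2 ^ N \<Longrightarrow> (\<Sum>i<N. of_bool (bit x i) * 2 ^ i) = (x::nat)"
  using enc_of_win[of x N 1]
  by (simp add: enc_def win_def take_bit_Suc bit_iff_odd drop_bit_eq_div mod_2_eq_odd)

text \<open>The windows of \<open>S\<close> hold the tail sums of the terms accepted by \<open>T\<close>. The recursion needs no
  end marker because all windows above the top bit of \<open>S\<close> are \<open>0\<close>.\<close>

definition isum :: "nat \<Rightarrow> nat \<Rightarrow> (nat \<Rightarrow> nat \<Rightarrow> bool) \<Rightarrow> nat \<Rightarrow> bool" where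
  "isum n W T v \<longleftrightarrow> (\<exists>S\<le>n. v = win W 0 S \<and>
     (\<forall>p\<le>n. W dvd p \<longrightarrow> (\<exists>t\<le>n. T p t \<and> win W p S = win W (p + W) S + t)))"

text \<open>The windows are read from the top down: they start at 0 and each step adds the only term
  that \<open>T\<close> accepts, so window 0 holds the whole sum.\<close>

lemma isum_sound:
  assumes "isum n W T v" "W > 0"
    and T: "\<And>i t. i * W \<le> n \<Longrightarrow> t \<le> n \<Longrightarrow> T (i * W) t \<Longrightarrow> t = u i"
  shows "v = (\<Sum>i\<le>n div W. u i)"
proof -
  from assms(1) obtain S where S: "S \<le> n" "v = win W 0 S"
    "\<And>p. p \<le> n \<Longrightarrow> W dvd p \<Longrightarrow> \<exists>t\<le>n. T p t \<and> win W p S = win W (p + W) S + t"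
    unfolding isum_def by blast
  define N where "N = Suc (n div W)"
  have "win W ((N - k) * W) S = (\<Sum>i=N-k..<N. u i)" if "k \<le> N" for k
    using that
  proof (induction k)
    case 0
    \<comment> \<open>Since \<open>S \<le> n < N * W\<close>, window \<open>N\<close> is empty, and
      the downward induction starts at 0.\<close>
    have "n < N * W" unfolding N_def using \<open>W > 0\<close> by (metis dividend_less_div_times mult_Suc plus_nat.simps(2) add.commute mult.commute)
    then have "S < 2 ^ (N * W)" using S(1) less_exp[of "N * W"] by linarith
    then show ?case by (simp add: win_eq_0)
  next
    case (Suc k)
    define i where "i = N - Suc k"
    have i: "N - k = Suc i" "i \<le> n div W" using Suc.prems by (auto simp: i_def N_def)
    then have le: "i * W \<le> n" using \<open>W > 0\<close> by (simp add: less_eq_div_iff_mult_less_eq)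
    from S(3)[OF le] obtain t where t: "t \<le> n" "T (i * W) t"
      "win W (i * W) S = win W (i * W + W) S + t" by auto
    have "win W (i * W) S = win W ((N - k) * W) S + u i"
      using t T[OF le t(1,2)] by (simp add: i add.commute)
    also have "\<dots> = (\<Sum>j=Suc i..<N. u j) + u i" using Suc by (simp add: i)
    also have "\<dots> = (\<Sum>j=i..<N. u j)" using i(2) sum.atLeast_Suc_lessThan[of i N u] by (simp add: N_def less_Suc_eq_le del: sum.op_ivl_Suc)
    finally show ?case by (simp add: i_def)
  qed
  from this[of N] show ?thesis using S(2)
    by (simp add: N_def lessThan_Suc_atMost atLeast0LessThan del: sum.lessThan_Suc)
qed

text \<open>The certificate has the tail sums as its digits. The two bounds say that
  \<open>N\<close> windows fit into a number at most \<open>n\<close> and that no tail sum overflows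
  its window.\<close>

lemma isum_complete:
  assumes "W > 0" "2 ^ (N * W) \<le> Suc n" "(\<Sum>i<N. u i) < 2 ^ W"
    and T: "\<And>i. i * W \<le> n \<Longrightarrow> T (i * W) (u i)"
    and z: "\<And>i. N \<le> i \<Longrightarrow> u i = 0"
  shows "isum n W T (\<Sum>i<N. u i)"
proof -
  define s where "s i = (\<Sum>j=i..<N. u j)" for i
  have sle: "s i < 2 ^ W" for i
    by (rule le_less_trans[OF _ assms(3)]) (auto simp: s_def intro!: sum_mono2)
  have s: "s i = s (Suc i) + u i" for i
    by (cases "i < N") (simp_all add: s_def sum.atLeast_Suc_lessThan z)
  define S where "S = enc W N s"
  have Sn: "S \<le> n" using enc_less[of N s W] sle assms(2) by (simp add: S_def)
  have w: "win W (i * W) S = s i" for i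
    using enc_win[of N s W i] sle by (simp add: S_def) (simp add: s_def)
  show ?thesis unfolding isum_def
  proof (rule exI[of _ S], intro conjI allI impI)
    show "S \<le> n" by (rule Sn)
    show "(\<Sum>i<N. u i) = win W 0 S" using w[of 0] by (simp add: s_def atLeast0LessThan)
  next
    fix p assume p: "p \<le> n" "W dvd p"
    then obtain i where i: "p = i * W" by (metis dvd_def mult.commute)
    have eq: "win W p S = win W (p + W) S + u i"
      using w[of i] w[of "Suc i"] s[of i] by (simp add: i add.commute)
    moreover have "win W p S \<le> n" using win_le Sn le_trans by blast
    ultimately show "\<exists>t\<le>n. T p t \<and> win W p S = win W (p + W) S + t"
      using T[of i] p(1) i by (intro exI[of _ "u i"]) auto
  qed
qed

section \<open>Multiplication by certificates\<close>

text \<open>Shift-and-add: the term at \<open>p = i * W\<close> is \<open>\<beta> * 2 ^ i\<close>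
  for every one bit \<open>i\<close> of \<open>\<alpha>\<close>, so the terms add up to the
  product.\<close>

definition dmul :: "nat \<Rightarrow> nat \<Rightarrow> nat \<Rightarrow> nat \<Rightarrow> nat \<Rightarrow> bool" where
  "dmul n W \<alpha> \<beta> \<gamma> \<longleftrightarrow>
     isum n W (\<lambda>p t. if bit \<alpha> (p div W) then t = \<beta> * 2 ^ (p div W) else t = 0) \<gamma>"

lemma dmul_sound:
  assumes "dmul n W \<alpha> \<beta> \<gamma>" "W > 0" "W * W \<le> n" "\<alpha> < 2 ^ W"
  shows "\<gamma> = \<alpha> * \<beta>"
proof -
  define N where "N = Suc (n div W)"
  \<comment> \<open>The sum runs over the indices up to \<open>n div W\<close>; as this is at least
    \<open>W\<close>, it reaches every bit of \<open>\<alpha>\<close>.\<close>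
  have "W \<le> n div W" using assms(2,3) by (simp add: less_eq_div_iff_mult_less_eq)
  then have "(2::nat) ^ W \<le> 2 ^ N" by (intro power_increasing) (auto simp: N_def)
  then have lt: "\<alpha> < 2 ^ N" using assms(4) by linarith
  have "\<gamma> = (\<Sum>i\<le>n div W. of_bool (bit \<alpha> i) * \<beta> * 2 ^ i)"
    using assms(1,2) unfolding dmul_def
    by (rule isum_sound) (use \<open>W > 0\<close> in \<open>auto split: if_splits\<close>)
  also have "\<dots> = (\<Sum>i<N. of_bool (bit \<alpha> i) * 2 ^ i) * \<beta>"
    unfolding N_def lessThan_Suc_atMost sum_distrib_right by (intro sum.cong) auto
  finally show ?thesis using sum_bits[OF lt] by simp
qed

text \<open>For factors of half width the product is below \<open>2 ^ (2 * w) \<le> 2 ^ W\<close>,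
  and \<open>w\<close> windows of width \<open>W\<close> take at most \<open>W * W\<close>
  bits.\<close>

lemma dmul_complete:
  assumes "2 * w \<le> W" "w > 0" "2 ^ (W * W) \<le> n" "\<alpha> < 2 ^ w" "\<beta> < 2 ^ w"
  shows "dmul n W \<alpha> \<beta> (\<alpha> * \<beta>)"
proof -
  define u where "u i = of_bool (bit \<alpha> i) * \<beta> * 2 ^ i" for i
  have "(\<Sum>i<w. u i) = (\<Sum>i<w. of_bool (bit \<alpha> i) * 2 ^ i) * \<beta>"
    unfolding u_def sum_distrib_right by (intro sum.cong) auto
  then have s: "(\<Sum>i<w. u i) = \<alpha> * \<beta>" using sum_bits[OF assms(4)] by simp
  have "\<alpha> * \<beta> < 2 ^ w * 2 ^ w" using assms(4,5) by (intro mult_strict_mono) auto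
  also have "\<dots> = 2 ^ (2 * w)" by (simp add: power_add[symmetric] mult_2)
  also have "\<dots> \<le> 2 ^ W" using assms(1) by (intro power_increasing) auto
  finally have lt: "\<alpha> * \<beta> < 2 ^ W" .
  have "(2::nat) ^ (w * W) \<le> 2 ^ (W * W)" using assms(1) by (intro power_increasing) auto
  then have 2: "2 ^ (w * W) \<le> Suc n" using assms(3) by linarith
  have "isum n W (\<lambda>p t. if bit \<alpha> (p div W) then t = \<beta> * 2 ^ (p div W) else t = 0) (\<Sum>i<w. u i)"
  proof (rule isum_complete)
    show "u i = 0" if "w \<le> i" for i
      using that bit_of_less_exp[OF assms(4), of i] by (auto simp: u_def)
  qed (use assms 2 lt s in \<open>auto simp: u_def\<close>)
  then show ?thesis by (simp add: dmul_def s)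
qed

text \<open>Column \<open>K = k * W\<close> of schoolbook multiplication in base
  \<open>2 ^ W\<close>; each digit product has its own nested certificate
  \<open>dmul\<close>.\<close>

definition col :: "nat \<Rightarrow> nat \<Rightarrow> nat \<Rightarrow> nat \<Rightarrow> nat \<Rightarrow> nat \<Rightarrow> bool" where
  "col n W A B K v \<longleftrightarrow> isum n W
     (\<lambda>p t. if p \<le> K then dmul n W (win W p A) (win W (K - p) B) t else t = 0) v"

text \<open>Every digit of \<open>P\<close> has to equal its whole convolution sum, so no carries
  between windows are tolerated.\<close>

definition smul :: "nat \<Rightarrow> nat \<Rightarrow> nat \<Rightarrow> nat \<Rightarrow> nat \<Rightarrow> bool" where
  "smul n W A B P \<longleftrightarrow> (\<forall>K\<le>n. W dvd K \<longrightarrow> col n W A B K (win W K P))"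

abbreviation conv :: "nat \<Rightarrow> nat \<Rightarrow> nat \<Rightarrow> nat \<Rightarrow> nat" where
  "conv W A B k \<equiv> \<Sum>i\<le>k. win W (i * W) A * win W ((k - i) * W) B"

lemma col_sound:
  assumes "col n W A B (k * W) v" "W > 0" "W * W \<le> n" "k * W \<le> n"
  shows "v = conv W A B k"
proof -
  have "v = (\<Sum>i\<le>n div W. if i \<le> k then win W (i * W) A * win W ((k - i) * W) B else 0)"
    using assms(1,2) unfolding col_def
  proof (rule isum_sound)
    fix i t
    assume "if i * W \<le> k * W then dmul n W (win W (i * W) A) (win W (k * W - i * W) B) t else t = 0"
    then show "t = (if i \<le> k then win W (i * W) A * win W ((k - i) * W) B else 0)"
      using dmul_sound[of n W "win W (i * W) A" "win W (k * W - i * W) B" t] assms(2,3)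
      by (auto simp: diff_mult_distrib split: if_splits)
  qed
  also have "\<dots> = (\<Sum>i\<in>{..n div W} \<inter> {i. i \<le> k}. win W (i * W) A * win W ((k - i) * W) B)"
    by (simp add: sum.inter_restrict)
  also have "{..n div W} \<inter> {i. i \<le> k} = {..k}"
    using assms(2,4) by (auto simp: less_eq_div_iff_mult_less_eq intro: le_trans)
  finally show ?thesis .
qed

lemma square_less_exp: "n * n < 2 ^ Suc n"
proof (induction n)
  case (Suc n)
  show ?case
  proof (cases "n < 3")
    case True
    then have "n = 0 \<or> n = 1 \<or> n = 2" by auto
    then show ?thesis by auto
  next
    case False
    then have "3 * n \<le> n * n" by (intro mult_le_mono1) simp
    moreover have "Suc n * Suc n = n * n + 2 * n + 1" by simp
    ultimately have "Suc n * Suc n \<le> 2 * (n * n)" using False by linarith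
    then show ?thesis using Suc by simp
  qed
qed simp

text \<open>The convolution may be cut off at index \<open>n div W\<close>: a nonzero digit product
  at \<open>i\<close> and \<open>j\<close> forces
  \<open>2 ^ ((i + j) * W) \<le> n * n < 2 ^ Suc n\<close>.\<close>

lemma mult_eq_enc_conv:
  assumes "A \<le> n" "B \<le> n" "W > 0"
  shows "A * B = enc W (Suc (n div W)) (conv W A B)"
proof -
  define N where "N = Suc (n div W)"
  define a b z where "a i = win W (i * W) A" and "b i = win W (i * W) B" and "z = (2::nat) ^ W" for i
  have z: "2 ^ (i * W) = z ^ i" for i by (simp add: z_def power_mult[symmetric] mult.commute)
  have nN: "n < N * W" unfolding N_def using assms(3)
    by (metis dividend_less_div_times mult_Suc plus_nat.simps(2) add.commute mult.commute)
  have "n < 2 ^ (N * W)" using nN less_exp[of "N * W"] by linarith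
  then have A: "A = (\<Sum>i<N. a i * z ^ i)" and B: "B = (\<Sum>i<N. b i * z ^ i)"
    using enc_of_win[of A N W] enc_of_win[of B N W] assms by (simp_all add: enc_def a_def b_def z)
  have 0: "a i * b j = 0" if "i + j \<ge> N" for i j
  proof (rule ccontr)
    assume "a i * b j \<noteq> 0"
    then have "2 ^ (i * W) \<le> A" "2 ^ (j * W) \<le> B"
      using win_eq_0[of A "i * W" W] win_eq_0[of B "j * W" W] by (auto simp: a_def b_def not_less[symmetric])
    then have "2 ^ (i * W) * 2 ^ (j * W) \<le> n * n" using assms(1,2) by (intro mult_le_mono) auto
    then have "2 ^ ((i + j) * W) \<le> n * n" by (simp add: power_add[symmetric] distrib_right)
    moreover have "N * W \<le> (i + j) * W" using that by simp
    then have "(2::nat) ^ Suc n \<le> 2 ^ ((i + j) * W)" using nN by (intro power_increasing) linarith+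
    ultimately show False using square_less_exp[of n] by linarith
  qed
  have "A * B = (\<Sum>(i,j)\<in>{..<N}\<times>{..<N}. a i * b j * z ^ (i + j))"
    unfolding A B by (simp add: sum_product sum.cartesian_product power_add ac_simps)
  also have "\<dots> = (\<Sum>(i,j)\<in>{(i,j). i + j < N}. a i * b j * z ^ (i + j))"
    proof (rule sum.mono_neutral_right)
    show "\<forall>x\<in>{..<N} \<times> {..<N} - {(i, j). i + j < N}. (case x of (i, j) \<Rightarrow> a i * b j * z ^ (i + j)) = 0"
    proof
      fix x assume "x \<in> {..<N} \<times> {..<N} - {(i, j). i + j < N}"
      then obtain i j where x: "x = (i, j)" "\<not> i + j < N" by (cases x) auto
      then have "a i * b j = 0" by (intro 0) simp
      then show "(case x of (i, j) \<Rightarrow> a i * b j * z ^ (i + j)) = 0" unfolding x by (simp only: prod.case mult_zero_left)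
    qed
  qed auto
  also have "\<dots> = (\<Sum>k<N. \<Sum>i\<le>k. a i * b (k - i) * z ^ (i + (k - i)))"
    by (rule sum.triangle_reindex)
  also have "\<dots> = (\<Sum>k<N. (\<Sum>i\<le>k. a i * b (k - i)) * z ^ k)"
    by (simp add: sum_distrib_right)
  finally show ?thesis by (simp add: enc_def a_def b_def z N_def del: sum.lessThan_Suc)
qed

text \<open>\<open>P\<close> and \<open>A * B\<close> are the same weighted sum of convolution
  values, whatever the factors look like; how full the windows are matters only for the existence of
  certificates.\<close>

lemma smul_sound:
  assumes "smul n W A B P" "W > 0" "W * W \<le> n" "A \<le> n" "B \<le> n" "P \<le> n"
  shows "P = A * B"
proof -
  define N where "N = Suc (n div W)"
  have nN: "n < N * W" unfolding N_def using assms(2)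
    by (metis dividend_less_div_times mult_Suc plus_nat.simps(2) add.commute mult.commute)
  then have "P < 2 ^ (N * W)" using less_exp[of "N * W"] assms(6) by linarith
  then have "P = enc W N (\<lambda>k. win W (k * W) P)" by (rule enc_of_win)
  also have "\<dots> = enc W N (conv W A B)"
    unfolding enc_def
  proof (intro sum.cong refl arg_cong2[where f = "(*)"])
    fix k assume "k \<in> {..<N}"
    then have "k * W \<le> n" using assms(2) by (simp add: N_def less_Suc_eq_le less_eq_div_iff_mult_less_eq)
    then show "win W (k * W) P = conv W A B k"
      using assms by (intro col_sound) (auto simp: smul_def)
  qed
  finally show ?thesis using mult_eq_enc_conv[OF assms(4,5,2)] by (simp add: N_def)
qed

definition sparse :: "nat \<Rightarrow> nat \<Rightarrow> nat \<Rightarrow> bool" where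
  "sparse W t x \<longleftrightarrow> (\<forall>i. win W (i * W) x < 2 ^ t)"

text \<open>The bound on \<open>a * 2 ^ W\<close> leaves one spare window, so that the windows of
  \<open>a\<close>, rounded up to full width, still fit into a certificate at most
  \<open>n\<close>.\<close>

definition complete_mul :: "nat \<Rightarrow> nat \<Rightarrow> nat \<Rightarrow> nat \<Rightarrow> (nat \<Rightarrow> nat \<Rightarrow> nat \<Rightarrow> bool) \<Rightarrow> bool" where
  "complete_mul n W s t M \<longleftrightarrow> (\<forall>a b. sparse W s a \<longrightarrow> sparse W t b \<longrightarrow> a * 2 ^ W \<le> n \<longrightarrow> b \<le> n \<longrightarrow>
     a * b \<le> n \<longrightarrow> M a b (a * b))"

text \<open>Digit products are below \<open>2 ^ (2 * w)\<close> and a column has at most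
  \<open>4 * W \<le> 2 ^ (2 * w)\<close> nonzero ones, so its sum is below
  \<open>2 ^ (4 * w) = 2 ^ W\<close>.\<close>

lemma smul_complete:
  assumes W: "W = 4 * w" "w > 0" and n: "2 ^ (W * W) \<le> n" "n < 2 ^ (4 * W * W)"
    and big: "4 * W \<le> 2 ^ (2 * w)"
  shows "complete_mul n W w w (smul n W)"
  unfolding complete_mul_def
proof (intro allI impI)
  fix A B
  assume sp: "sparse W w A" "sparse W w B" and A: "A * 2 ^ W \<le> n" and B: "B \<le> n" and AB: "A * B \<le> n"
  have "A * 1 \<le> A * 2 ^ W" by (intro mult_le_mono2) simp
  then have An: "A \<le> n" using A by linarith
  have "\<exists>N. A < 2 ^ (N * W) \<and> N \<le> 4 * W \<and> 2 ^ (N * W) \<le> n"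
  proof (cases "A = 0")
    case True
    have "(1::nat) \<le> 2 ^ (W * W)" by simp
    then have "1 \<le> n" using n(1) by linarith
    then show ?thesis using True by (intro exI[of _ 0]) simp
  next
    case False
    \<comment> \<open>Minimality gives \<open>2 ^ ((N - 1) * W) \<le> A\<close>, which the bound on
      \<open>A * 2 ^ W\<close> turns into \<open>2 ^ (N * W) \<le> n\<close>.\<close>
    define N where "N = (LEAST N. A < 2 ^ (N * W))"
    have *: "A < 2 ^ (4 * W * W)" using An n by linarith
    have 1: "A < 2 ^ (N * W)" unfolding N_def by (rule LeastI[of _ "4 * W"]) (use * in simp)
    have 2: "N \<le> 4 * W" unfolding N_def by (rule Least_le) (use * in simp)
    have "N \<noteq> 0" using 1 False by (intro notI) simp
    then obtain N' where N': "N = Suc N'" by (cases N) auto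
    have "\<not> A < 2 ^ (N' * W)" using not_less_Least[of N' "\<lambda>N. A < 2 ^ (N * W)"] N'
      by (simp add: N_def[symmetric])
    then have "2 ^ (N' * W) * 2 ^ W \<le> A * 2 ^ W" by simp
    then have "2 ^ (N' * W) * 2 ^ W \<le> n" using A by linarith
    then have "2 ^ (N * W) \<le> n" by (simp add: N' power_add mult.commute)
    then show ?thesis using 1 2 by blast
  qed
  then obtain N where N: "A < 2 ^ (N * W)" "N \<le> 4 * W" "2 ^ (N * W) \<le> n" by blast
  have Az: "win W (i * W) A = 0" if "N \<le> i" for i
  proof (rule win_eq_0)
    have "(2::nat) ^ (N * W) \<le> 2 ^ (i * W)" using that by (intro power_increasing) auto
    then show "A < 2 ^ (i * W)" using N(1) by linarith
  qed
  define u where "u k i = (if i \<le> k then win W (i * W) A * win W ((k - i) * W) B else 0)" for k i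
  have u_le: "u k i \<le> 2 ^ (2 * w) - 1" for k i
  proof -
    have "win W (i * W) A * win W ((k - i) * W) B < 2 ^ w * 2 ^ w"
      using sp by (intro mult_strict_mono) (auto simp: sparse_def)
    then show ?thesis by (auto simp: u_def power_add mult_2)
  qed
  have uz: "u k i = 0" if "N \<le> i" for k i using Az[OF that] by (simp add: u_def)
  have su: "(\<Sum>i<N. u k i) = conv W A B k" for k
  proof -
    have "(\<Sum>i<N. u k i) = (\<Sum>i<N + Suc k. u k i)"
      by (rule sum.mono_neutral_left) (auto simp: uz)
    also have "\<dots> = (\<Sum>i\<in>{..<N + Suc k} \<inter> {i. i \<le> k}. win W (i * W) A * win W ((k - i) * W) B)"
      unfolding u_def by (simp add: sum.inter_restrict)
    also have "{..<N + Suc k} \<inter> {i. i \<le> k} = {..k}" by auto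
    finally show ?thesis .
  qed
  have lt: "(\<Sum>i<N. u k i) < 2 ^ W" for k
  proof -
    have "(\<Sum>i<N. u k i) \<le> N * (2 ^ (2 * w) - 1)" using sum_bounded_above[of "{..<N}" "u k" "2 ^ (2 * w) - 1"] u_le by simp
    also have "\<dots> \<le> 2 ^ (2 * w) * (2 ^ (2 * w) - 1)" using N(2) big by (intro mult_le_mono1) linarith
    also have "\<dots> < 2 ^ (2 * w) * 2 ^ (2 * w)" by (intro mult_strict_left_mono) auto
    also have "\<dots> = 2 ^ W" by (simp add: W power_add[symmetric])
    finally show ?thesis .
  qed
  show "smul n W A B (A * B)"
    unfolding smul_def
  proof (intro allI impI)
    fix K assume K: "K \<le> n" "W dvd K"
    then obtain k where k: "K = k * W" by (metis dvd_def mult.commute)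
    have W0: "W > 0" using W by simp
    have "k < Suc (n div W)" using K W0 by (simp add: k less_Suc_eq_le less_eq_div_iff_mult_less_eq)
    then have "win W K (A * B) = conv W A B k"
      using enc_win[of "Suc (n div W)" "conv W A B" W k] lt su
      by (simp add: mult_eq_enc_conv[OF An B W0] k)
    moreover have "col n W A B K (\<Sum>i<N. u k i)"
      unfolding col_def
    proof (rule isum_complete)
      fix i
      show "if i * W \<le> K then dmul n W (win W (i * W) A) (win W (K - i * W) B) (u k i) else u k i = 0"
        using sp W0 dmul_complete[OF _ W(2) n(1), of "win W (i * W) A" "win W ((k - i) * W) B"]
        by (auto simp: k u_def sparse_def diff_mult_distrib[symmetric] W)
    qed (use N W0 lt uz in auto)
    ultimately show "col n W A B K (win W K (A * B))" by (simp add: su)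
  qed
qed

section \<open>From sparse factors to arbitrary ones\<close>

definition distr :: "nat \<Rightarrow> (nat \<Rightarrow> nat \<Rightarrow> nat \<Rightarrow> bool) \<Rightarrow> nat \<Rightarrow> nat \<Rightarrow> nat \<Rightarrow> bool" where
  "distr n M a b x \<longleftrightarrow> (\<exists>h\<le>n. \<exists>a1\<le>n. \<exists>a2\<le>n. \<exists>x1\<le>n. \<exists>x2\<le>n.
     a = a1 + a2 * 2 ^ h \<and> x = x1 + x2 * 2 ^ h \<and> M a1 b x1 \<and> M a2 b x2)"

definition sound_mul :: "nat \<Rightarrow> (nat \<Rightarrow> nat \<Rightarrow> nat \<Rightarrow> bool) \<Rightarrow> bool" where
  "sound_mul n M \<longleftrightarrow> (\<forall>a\<le>n. \<forall>b\<le>n. \<forall>x\<le>n. M a b x \<longrightarrow> x = a * b)"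

text \<open>Distributivity holds for every split, so guessing \<open>h\<close> and the summands
  cannot spoil soundness.\<close>

lemma distr_sound:
  assumes "sound_mul n M"
  shows "sound_mul n (distr n M)"
  unfolding sound_mul_def
proof (intro allI impI)
  fix a b x assume "b \<le> n" "distr n M a b x"
  then obtain h a1 a2 x1 x2 where h: "a1 \<le> n" "a2 \<le> n" "x1 \<le> n" "x2 \<le> n"
    "a = a1 + a2 * 2 ^ h" "x = x1 + x2 * 2 ^ h" "M a1 b x1" "M a2 b x2"
    unfolding distr_def by blast
  then have "x1 = a1 * b" "x2 = a2 * b" using assms \<open>b \<le> n\<close> by (auto simp: sound_mul_def)
  then show "x = a * b" by (simp add: h algebra_simps)
qed

text \<open>Every window is cut into its low \<open>t\<close> and its high \<open>t\<close> bits;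
  the low halves form \<open>x1\<close>, and the high halves, moved down by \<open>t\<close>, form
  \<open>x2\<close>.\<close>

lemma sparse_split:
  assumes "sparse W (2 * t) x" "2 * t \<le> W" "W > 0"
  shows "\<exists>x1 x2. x = x1 + x2 * 2 ^ t \<and> sparse W t x1 \<and> sparse W t x2"
proof -
  \<comment> \<open>\<open>x\<close> windows are enough, since \<open>x < 2 ^ x\<close>.\<close>
  define N where "N = x"
  have "x < 2 ^ x" by simp
  also have "(2::nat) ^ x \<le> 2 ^ (x * W)" using assms(3) by (intro power_increasing) auto
  finally have x: "x = enc W N (\<lambda>i. win W (i * W) x)" unfolding N_def by (rule enc_of_win)
  define s1 s2 where "s1 i = win W (i * W) x mod 2 ^ t" and "s2 i = win W (i * W) x div 2 ^ t" for i
  have b: "s1 i < 2 ^ t" "s2 i < 2 ^ t" for i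
    using assms(1) by (auto simp: s1_def s2_def sparse_def mult_2 power_add less_mult_imp_div_less)
  have "(2::nat) ^ t \<le> 2 ^ W" using assms(2) by (intro power_increasing) auto
  then have b': "s1 i < 2 ^ W" "s2 i < 2 ^ W" for i using b[of i] by linarith+
  have "sparse W t (enc W N s1)" "sparse W t (enc W N s2)"
    using b b' by (auto simp: sparse_def enc_win)
  moreover have "x = enc W N s1 + enc W N s2 * 2 ^ t"
  proof -
    have "enc W N s1 + enc W N s2 * 2 ^ t = enc W N (\<lambda>i. s1 i + s2 i * 2 ^ t)"
      unfolding enc_def sum_distrib_right sum.distrib[symmetric]
      by (intro sum.cong refl) (simp add: algebra_simps)
    also have "\<dots> = enc W N (\<lambda>i. win W (i * W) x)" by (simp add: s1_def s2_def mod_div_mult_eq)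
    finally show ?thesis using x by (rule trans[OF _ sym, rotated])
  qed
  ultimately show ?thesis by blast
qed

lemma distr_complete:
  assumes "complete_mul n W s t M" "2 * s \<le> W" "W > 0" "W \<le> n"
  shows "complete_mul n W (2 * s) t (distr n M)"
  unfolding complete_mul_def
proof (intro allI impI)
  fix a b assume a: "sparse W (2 * s) a" "sparse W t b" "a * 2 ^ W \<le> n" "b \<le> n" "a * b \<le> n"
  from sparse_split[OF a(1) assms(2,3)] obtain a1 a2 where
    a12: "a = a1 + a2 * 2 ^ s" "sparse W s a1" "sparse W s a2" by blast
  have "a2 * 1 \<le> a2 * 2 ^ s" by (intro mult_le_mono2) simp
  then have le: "a1 \<le> a" "a2 \<le> a" unfolding a12(1) by linarith+
  have an: "a1 * 2 ^ W \<le> n" "a2 * 2 ^ W \<le> n"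
    using le a(3) by (meson le_trans mult_le_mono1)+
  have bn: "a1 * b \<le> n" "a2 * b \<le> n"
    using le a(5) by (meson le_trans mult_le_mono1)+
  have "a1 * 1 \<le> a1 * 2 ^ W" "a2 * 1 \<le> a2 * 2 ^ W" by (intro mult_le_mono2; simp)+
  then have "a1 \<le> n" "a2 \<le> n" using an by linarith+
  moreover have "M a1 b (a1 * b)" "M a2 b (a2 * b)"
    using assms(1) a12 a an bn by (auto simp: complete_mul_def)
  moreover have "s \<le> n" using assms by linarith
  ultimately show "distr n M a b (a * b)"
    unfolding distr_def using bn a12(1)
    by (intro exI[of _ s] exI[of _ a1] exI[of _ a2] exI[of _ "a1 * b"] exI[of _ "a2 * b"] conjI)
       (auto simp: algebra_simps)
qed

definition distr' :: "nat \<Rightarrow> (nat \<Rightarrow> nat \<Rightarrow> nat \<Rightarrow> bool) \<Rightarrow> nat \<Rightarrow> nat \<Rightarrow> nat \<Rightarrow> bool" where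
  "distr' n M a b x \<longleftrightarrow> distr n (\<lambda>b a. M a b) b a x"

lemma distr'_sound: "sound_mul n M \<Longrightarrow> sound_mul n (distr' n M)"
proof -
  assume "sound_mul n M"
  then have "sound_mul n (\<lambda>b a. M a b)" unfolding sound_mul_def by (metis mult.commute)
  from distr_sound[OF this] show ?thesis unfolding sound_mul_def distr'_def by (metis mult.commute)
qed

lemma distr'_complete:
  assumes "complete_mul n W s t M" "2 * t \<le> W" "W > 0" "W \<le> n"
  shows "complete_mul n W s (2 * t) (distr' n M)"
  unfolding complete_mul_def
proof (intro allI impI)
  fix a b assume a: "sparse W s a" "sparse W (2 * t) b" "a * 2 ^ W \<le> n" "b \<le> n" "a * b \<le> n"
  from sparse_split[OF a(2) assms(2,3)] obtain b1 b2 where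
    b12: "b = b1 + b2 * 2 ^ t" "sparse W t b1" "sparse W t b2" by blast
  have "b2 * 1 \<le> b2 * 2 ^ t" by (intro mult_le_mono2) simp
  then have le: "b1 \<le> b" "b2 \<le> b" unfolding b12(1) by linarith+
  have bn: "a * b1 \<le> n" "a * b2 \<le> n"
    using le a(5) by (meson le_trans mult_le_mono2)+
  have "b1 \<le> n" "b2 \<le> n" using le a(4) by linarith+
  moreover have "M a b1 (a * b1)" "M a b2 (a * b2)"
    using assms(1) b12 a bn \<open>b1 \<le> n\<close> \<open>b2 \<le> n\<close> by (auto simp: complete_mul_def)
  moreover have "t \<le> n" using assms by linarith
  ultimately show "distr' n M a b (a * b)"
    unfolding distr_def distr'_def using bn b12(1)
    by (intro exI[of _ t] exI[of _ b1] exI[of _ b2] exI[of _ "a * b1"] exI[of _ "a * b2"] conjI)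
       (auto simp: algebra_simps)
qed

text \<open>Two splits of each factor raise the number of bits allowed per window from a quarter of
  \<open>W\<close> to \<open>W\<close>, where \<open>sparse\<close> holds for every number.\<close>

definition wmul :: "nat \<Rightarrow> nat \<Rightarrow> nat \<Rightarrow> nat \<Rightarrow> nat \<Rightarrow> bool" where
  "wmul n W = distr n (distr n (distr' n (distr' n (smul n W))))"

lemma wmul_sound:
  assumes "W > 0" "W * W \<le> n" "a \<le> n" "b \<le> n" "x \<le> n" "wmul n W a b x"
  shows "x = a * b"
proof -
  have "sound_mul n (smul n W)" using smul_sound assms(1,2) by (auto simp: sound_mul_def)
  then have "sound_mul n (wmul n W)" unfolding wmul_def by (intro distr_sound distr'_sound)
  then show ?thesis using assms by (auto simp: sound_mul_def)
qed

text \<open>The largest \<open>f\<close> with \<open>2 ^ (2 ^ (f + f)) \<le> n\<close> is taken.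
  With \<open>W = 2 ^ f\<close> this is \<open>2 ^ (W * W) \<le> n\<close>, and maximality gives
  \<open>n < 2 ^ (4 * W * W)\<close>, which bounds the number of windows. Since
  \<open>256 = 2 ^ (4 + 4)\<close>, \<open>f\<close> is at least 4.\<close>

lemma wmul_complete:
  assumes n: "2 ^ 256 \<le> n"
  shows "\<exists>f. 2 ^ (2 ^ (f + f)) \<le> n \<and> (\<forall>a b. a \<le> b \<longrightarrow> b \<le> n \<longrightarrow> a * b \<le> n \<longrightarrow> wmul n (2 ^ f) a b (a * b))"
proof -
  define Q where "Q f \<longleftrightarrow> 2 ^ (2 ^ (f + f)) \<le> n" for f :: nat
  have Q4: "Q 4" using n by (simp add: Q_def)
  have bnd: "f \<le> n" if "Q f" for f
  proof -
    have "f < 2 ^ f" by simp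
    also have "(2::nat) ^ f \<le> 2 ^ (f + f)" by (intro power_increasing) auto
    also have "\<dots> < 2 ^ (2 ^ (f + f))" by simp
    finally show ?thesis using that by (simp add: Q_def)
  qed
  define f where "f = (GREATEST f. Q f)"
  have Qf: "Q f" unfolding f_def using Q4 bnd by (rule GreatestI_nat)
  have f4: "4 \<le> f" unfolding f_def using Q4 bnd by (rule Greatest_le_nat)
  have nQ: "\<not> Q (Suc f)" using Greatest_le_nat[of Q "Suc f" n] bnd by (auto simp: f_def)
  define W w where "W = (2::nat) ^ f" and "w = (2::nat) ^ (f - 2)"
  have "f = 2 + (f - 2)" using f4 by simp
  then have "(2::nat) ^ f = 2 ^ 2 * 2 ^ (f - 2)" by (metis power_add)
  then have W: "W = 4 * w" "w > 0" unfolding W_def w_def by simp_all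
  have W16: "16 \<le> W" unfolding W_def using power_increasing[OF f4, of "2::nat"] by simp
  have WW: "2 ^ (f + f) = W * W" by (simp add: W_def power_add)
  have n1: "2 ^ (W * W) \<le> n" using Qf by (simp add: Q_def WW)
  have n2: "n < 2 ^ (4 * W * W)" using nQ WW by (simp add: Q_def not_le ac_simps)
  \<comment> \<open>\<open>w \<ge> 4\<close> is enough for
    \<open>16 * w \<le> 2 ^ (2 * w)\<close>.\<close>
  have big: "4 * W \<le> 2 ^ (2 * w)"
  proof -
    have "w \<ge> 4" using W16 W by simp
    then obtain v where v: "w = 4 + v" using le_Suc_ex by blast
    have "16 * (4 + v) \<le> 2 ^ (8 + 2 * v)"
      by (induction v) (simp_all add: power_add)
    then show ?thesis using W v by simp
  qed
  have "W < 2 ^ W" by simp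
  also have "(2::nat) ^ W \<le> 2 ^ (W * W)" by (intro power_increasing) auto
  finally have Wn: "W \<le> n" using n1 by simp
  have "complete_mul n W (2 * (2 * w)) (2 * (2 * w)) (wmul n W)"
    unfolding wmul_def using W Wn
    by (intro distr_complete distr'_complete smul_complete[OF W n1 n2 big]) auto
  then have c: "complete_mul n W W W (wmul n W)" using W by simp
  have "wmul n W a b (a * b)" if "a \<le> b" "b \<le> n" "a * b \<le> n" for a b
  proof -
    \<comment> \<open>Both \<open>a\<close> and \<open>2 ^ W\<close> are at most the square root of
      \<open>n\<close>: \<open>a * a \<le> a * b \<le> n\<close> and
      \<open>2 * W \<le> W * W\<close>. The squares are compared instead.\<close>
    have "a * 2 ^ W \<le> n"
    proof (rule ccontr)
      assume "\<not> a * 2 ^ W \<le> n"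
      then have "n < a * 2 ^ W" by simp
      then have "n * n < (a * 2 ^ W) * (a * 2 ^ W)" by (intro mult_strict_mono) (linarith | simp)+
      also have "\<dots> = (a * a) * 2 ^ (2 * W)" by (simp add: power_add mult_2)
      also have "\<dots> \<le> n * n"
      proof (intro mult_le_mono)
        show "a * a \<le> n" using mult_le_mono2[OF that(1), of a] that(3) by linarith
        have "(2::nat) ^ (2 * W) \<le> 2 ^ (W * W)" using W16 by (intro power_increasing) auto
        then show "2 ^ (2 * W) \<le> n" using n1 by linarith
      qed
      finally show False by simp
    qed
    then show ?thesis using c that by (auto simp: complete_mul_def sparse_def)
  qed
  then show ?thesis using Qf by (auto simp: Q_def W_def)
qed

section \<open>Pairs of coordinates and parity\<close>

lemma q_Suc: "q (Suc i) = q i + Suc i"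
proof -
  have "Suc i * (Suc i + 1) = i * (i + 1) + 2 * Suc i" by simp
  then show ?thesis unfolding q_def by (metis div_mult_self4 add.commute zero_neq_numeral)
qed

lemma q_0 [simp]: "q 0 = 0" by (simp add: q_def)

lemma q_strict_mono: "strict_mono q"
  by (simp add: strict_mono_Suc_iff q_Suc)

lemma q_ge: "i \<le> q i"
  by (induction i) (simp_all add: q_Suc)

lemma cc_eqI: "q i \<le> x \<Longrightarrow> x < q (Suc i) \<Longrightarrow> cc x = i"
  unfolding cc_def
proof (rule Greatest_equality)
  fix j assume "x < q (Suc i)" "q j \<le> x"
  then have "q j < q (Suc i)" by linarith
  then show "j \<le> i" by (simp add: strict_mono_less[OF q_strict_mono] less_Suc_eq_le)
qed

lemma cc_bounds: "q (cc x) \<le> x" "x < q (Suc (cc x))"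
proof -
  have b: "i \<le> x" if "q i \<le> x" for i using q_ge[of i] that by linarith
  show "q (cc x) \<le> x" unfolding cc_def by (rule GreatestI_nat[of _ 0]) (use b in auto)
  show "x < q (Suc (cc x))"
  proof (rule ccontr)
    assume "\<not> x < q (Suc (cc x))"
    then have "q (Suc (cc x)) \<le> x" by simp
    then have "Suc (cc x) \<le> cc x"
      unfolding cc_def[of x] by (rule Greatest_le_nat) (rule b)
    then show False by simp
  qed
qed

lemma eq_q_plus_rr: "x = q (cc x) + rr x" using cc_bounds(1) by (simp add: rr_def)

lemma rr_le: "rr x \<le> cc x" using cc_bounds(2)[of x] by (simp add: rr_def q_Suc)

lemma cc_pt [simp]: "r \<le> c \<Longrightarrow> cc (q c + r) = c"
  by (rule cc_eqI) (simp_all add: q_Suc)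

lemma rr_pt [simp]: "r \<le> c \<Longrightarrow> rr (q c + r) = r"
  by (simp add: rr_def)

text \<open>Column \<open>c\<close> is the interval from \<open>q c\<close> to
  \<open>q (Suc c) - 1\<close>, so \<open><\<close> compares columns first, whereas
  \<open>tri_less\<close> compares rows first.\<close>

lemma less_iff_coords: "x < y \<longleftrightarrow> cc x < cc y \<or> cc x = cc y \<and> rr x < rr y"
proof -
  have *: "x < y" if "cc x < cc y" for x y
  proof -
    have "q (Suc (cc x)) \<le> q (cc y)" using that by (simp add: strict_mono_less_eq[OF q_strict_mono])
    then show ?thesis using cc_bounds(2)[of x] cc_bounds(1)[of y] by linarith
  qed
  show ?thesis
  proof (cases "cc x" "cc y" rule: linorder_cases)
    case equal
    then have "x < y \<longleftrightarrow> rr x < rr y" using eq_q_plus_rr[of x] eq_q_plus_rr[of y] by (metis add_less_cancel_left)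
    then show ?thesis using equal by simp
  qed (use *[of x y] *[of y x] in auto)
qed

lemma eq_iff_coords: "x = y \<longleftrightarrow> cc x = cc y \<and> rr x = rr y"
  using eq_q_plus_rr by metis

lemma less_q_iff: "x < q m \<longleftrightarrow> cc x < m"
proof
  assume "x < q m"
  then have "q (cc x) < q m" using cc_bounds(1)[of x] by linarith
  then show "cc x < m" by (simp add: strict_mono_less[OF q_strict_mono])
next
  assume "cc x < m"
  then have "q (Suc (cc x)) \<le> q m" by (simp add: strict_mono_less_eq[OF q_strict_mono])
  then show "x < q m" using cc_bounds(2)[of x] by linarith
qed

section \<open>The Ehrenfeucht-Fraisse game\<close>

text \<open>The usual invariant of games on linear orders: distances are kept exactly below the
  threshold \<open>d\<close>, and beyond it only their direction is kept.\<close>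

definition close :: "int \<Rightarrow> ('i \<Rightarrow> int) \<Rightarrow> ('i \<Rightarrow> int) \<Rightarrow> bool" where
  "close d f g \<longleftrightarrow> (\<forall>i j. f i - f j = g i - g j \<or> (f i - f j \<ge> d \<and> g i - g j \<ge> d)
      \<or> (f i - f j \<le> - d \<and> g i - g j \<le> - d))"

lemma close_mono: "close d f g \<Longrightarrow> d' \<le> d \<Longrightarrow> close d' f g"
  unfolding close_def by (meson le_minus_iff neg_le_iff_le order_trans)

lemma close_le_iff: "close d f g \<Longrightarrow> d \<ge> 1 \<Longrightarrow> f i \<le> f j \<longleftrightarrow> g i \<le> g j"
  unfolding close_def by (drule spec[of _ i], drule spec[of _ j]) linarith

lemma close_sym: "close d f g \<Longrightarrow> close d g f"
  unfolding close_def by metis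

text \<open>One move halves the threshold. The named points \<open>b\<close> and \<open>t\<close>
  guarantee that \<open>x\<close> has a nearest named point \<open>i\<close> at or below it and a
  nearest one \<open>j\<close> at or above it.\<close>

lemma close_extend:
  assumes c: "close (2 * d) f g" and d: "d \<ge> 1" and lo: "f b \<le> x" and hi: "x \<le> f t"
  shows "\<exists>y. close d (f(k := x)) (g(k := y))"
proof -
  have "\<exists>i. f i \<le> x \<and> (\<forall>j. f j \<le> x \<longrightarrow> f j \<le> f i)"
  proof -
    obtain i where i: "f i \<le> x" "\<And>j. f j \<le> x \<Longrightarrow> nat (x - f i) \<le> nat (x - f j)"
      using ex_has_least_nat[of "\<lambda>i. f i \<le> x" b "\<lambda>i. nat (x - f i)"] lo by blast
    then have "f j \<le> f i" if "f j \<le> x" for j using i(2)[OF that] that i(1) by linarith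
    then show ?thesis using i(1) by blast
  qed
  then obtain i where i: "f i \<le> x" "\<And>j. f j \<le> x \<Longrightarrow> f j \<le> f i" by blast
  have "\<exists>i. f i \<ge> x \<and> (\<forall>j. f j \<ge> x \<longrightarrow> f j \<ge> f i)"
  proof -
    obtain i where i: "f i \<ge> x" "\<And>j. f j \<ge> x \<Longrightarrow> nat (f i - x) \<le> nat (f j - x)"
      using ex_has_least_nat[of "\<lambda>i. f i \<ge> x" t "\<lambda>i. nat (f i - x)"] hi by blast
    then have "f j \<ge> f i" if "f j \<ge> x" for j using i(2)[OF that] that i(1) by linarith
    then show ?thesis using i(1) by blast
  qed
  then obtain j where j: "f j \<ge> x" "\<And>l. f l \<ge> x \<Longrightarrow> f l \<ge> f j" by blast
  \<comment> \<open>A distance below \<open>d\<close> to a neighbour is copied. Otherwise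
    \<open>f i\<close> and \<open>f j\<close> are at least \<open>2 * d\<close> apart, hence so are
    \<open>g i\<close> and \<open>g j\<close>, and \<open>g i + d\<close> is far from both.\<close>
  define y where "y = (if x - f i < d then g i + (x - f i)
      else if f j - x < d then g j - (f j - x) else g i + d)"
  have rel: "f a - f b = g a - g b \<or> (f a - f b \<ge> 2 * d \<and> g a - g b \<ge> 2 * d)
      \<or> (f a - f b \<le> - (2 * d) \<and> g a - g b \<le> - (2 * d))" for a b
    using c unfolding close_def by blast
  have main: "f l - x = g l - y \<or> (f l - x \<ge> d \<and> g l - y \<ge> d) \<or> (f l - x \<le> - d \<and> g l - y \<le> - d)" for l
    using rel[of l i] rel[of l j] rel[of j i] i(1) i(2)[of l] j(1) j(2)[of l] d
    unfolding y_def by (smt (verit))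
  have "close d (f(k := x)) (g(k := y))"
    unfolding close_def
  proof (intro allI)
    fix a b
    show "(f(k := x)) a - (f(k := x)) b = (g(k := y)) a - (g(k := y)) b \<or>
           d \<le> (f(k := x)) a - (f(k := x)) b \<and> d \<le> (g(k := y)) a - (g(k := y)) b \<or>
           (f(k := x)) a - (f(k := x)) b \<le> - d \<and> (g(k := y)) a - (g(k := y)) b \<le> - d"
      using main[of a] main[of b] rel[of a b] d by (auto simp: fun_upd_def)
  qed
  then show ?thesis by blast
qed

text \<open>The named points: both ends of the order, which keep the answers inside it, and the two
  coordinates of every variable.\<close>

datatype pos = Bot | Top | ColOf nat | RowOf nat

fun coord :: "nat \<Rightarrow> (nat \<Rightarrow> nat) \<Rightarrow> pos \<Rightarrow> int" where
  "coord m \<sigma> Bot = 0"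
| "coord m \<sigma> Top = int m"
| "coord m \<sigma> (ColOf v) = int (cc (\<sigma> v))"
| "coord m \<sigma> (RowOf v) = int (rr (\<sigma> v))"

fun qr :: "'p fo \<Rightarrow> nat" where
  "qr (Neg \<phi>) = qr \<phi>"
| "qr (Conj \<phi> \<psi>) = max (qr \<phi>) (qr \<psi>)"
| "qr (Ex x \<phi>) = Suc (qr \<phi>)"
| "qr _ = 0"

lemma coord_upd: "coord m (\<sigma>(x := a)) = (coord m \<sigma>)(ColOf x := int (cc a), RowOf x := int (rr a))"
proof
  fix p show "coord m (\<sigma>(x := a)) p = ((coord m \<sigma>)(ColOf x := int (cc a), RowOf x := int (rr a))) p"
    by (cases p) auto
qed

text \<open>Choosing \<open>a\<close> means choosing its column and then its row. These are two
  moves on the order, hence the factor 4.\<close>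

lemma close_move:
  assumes c: "close (4 * d) (coord m \<sigma>) (coord m' \<sigma>')" and d: "d \<ge> 1" and a: "a < q m"
  shows "\<exists>a'<q m'. close d (coord m (\<sigma>(x := a))) (coord m' (\<sigma>'(x := a')))"
proof -
  have ca: "cc a < m" and ra: "rr a \<le> cc a" using a less_q_iff rr_le by auto
  have c': "close (2 * (2 * d)) (coord m \<sigma>) (coord m' \<sigma>')" using c by simp
  obtain c1 where c1: "close (2 * d) ((coord m \<sigma>)(ColOf x := int (cc a))) ((coord m' \<sigma>')(ColOf x := c1))"
    using close_extend[OF c', of Bot "int (cc a)" Top "ColOf x"] ca d by auto
  obtain r1 where r1: "close d ((coord m \<sigma>)(ColOf x := int (cc a), RowOf x := int (rr a)))
      ((coord m' \<sigma>')(ColOf x := c1, RowOf x := r1))"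
    using close_extend[OF c1 d, of Bot "int (rr a)" Top "RowOf x"] ca ra by auto
  note le = close_le_iff[OF r1 d]
  \<comment> \<open>The invariant preserves the order of named points, so the coordinates of
    \<open>a\<close> being legal makes \<open>r1\<close> and \<open>c1\<close> legal for
    \<open>m'\<close>.\<close>
  have "0 \<le> r1" using le[of Bot "RowOf x"] by simp
  moreover have "r1 \<le> c1" using le[of "RowOf x" "ColOf x"] ra by simp
  moreover have "\<not> int m' \<le> c1" using le[of Top "ColOf x"] ca by simp
  ultimately obtain c2 r2 where cr: "c1 = int c2" "r1 = int r2" "r2 \<le> c2" "c2 < m'"
    by (metis int_nat_eq nat_le_iff nonneg_int_cases of_nat_le_iff of_nat_less_iff not_le le_trans order_trans)
  have "close d (coord m (\<sigma>(x := a))) (coord m' (\<sigma>'(x := q c2 + r2)))"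
    using r1 cr by (simp add: coord_upd)
  moreover have "q c2 + r2 < q m'" using cr by (simp add: less_q_iff)
  ultimately show ?thesis by blast
qed

text \<open>Each quantifier costs a factor 4, and at threshold 1 the invariant fixes the order of
  all coordinates and thereby all numerical atoms. \<open>Suc m\<close> makes
  \<open>q (Suc m)\<close> positive, so that \<open>q (Suc m) - 1\<close> is the last of
  \<open>q (Suc m)\<close> elements.\<close>

lemma sat_close:
  assumes "close (4 ^ qr \<phi>) (coord (Suc m) \<sigma>) (coord (Suc m') \<sigma>')"
    and "\<forall>v. \<sigma> v < q (Suc m)" "\<forall>v. \<sigma>' v < q (Suc m')"
  shows "sat pred_lt_tri (q (Suc m) - 1) (\<lambda>_. {}) \<phi> \<sigma> \<longleftrightarrow> sat pred_lt_tri (q (Suc m') - 1) (\<lambda>_. {}) \<phi> \<sigma>'"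
  using assms
proof (induction \<phi> arbitrary: \<sigma> \<sigma>')
  case (Eq x y)
  note le = close_le_iff[OF Eq(1)]
  have "cc (\<sigma> x) = cc (\<sigma> y) \<longleftrightarrow> cc (\<sigma>' x) = cc (\<sigma>' y)"
    using le[of "ColOf x" "ColOf y"] le[of "ColOf y" "ColOf x"] by (simp add: order_eq_iff)
  moreover have "rr (\<sigma> x) = rr (\<sigma> y) \<longleftrightarrow> rr (\<sigma>' x) = rr (\<sigma>' y)"
    using le[of "RowOf x" "RowOf y"] le[of "RowOf y" "RowOf x"] by (simp add: order_eq_iff)
  ultimately show ?case by (metis sat.simps(1) eq_iff_coords)
next
  case (Num P xs)
  note le = close_le_iff[OF Num(1)]
  have lt: "(coord (Suc m) \<sigma> i < coord (Suc m) \<sigma> j) = (coord (Suc m') \<sigma>' i < coord (Suc m') \<sigma>' j)" for i j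
    using le[of j i] by (metis not_le one_le_power one_le_numeral)
  have b: "\<forall>a\<in>set xs. \<sigma> a \<le> q (Suc m) - 1" "\<forall>a\<in>set xs. \<sigma>' a \<le> q (Suc m') - 1"
    using Num(2,3) by (auto simp: q_Suc less_Suc_eq_le)
  have atom: "(\<sigma> x < \<sigma> y \<longleftrightarrow> \<sigma>' x < \<sigma>' y) \<and> (tri_less (\<sigma> x) (\<sigma> y) \<longleftrightarrow> tri_less (\<sigma>' x) (\<sigma>' y))" for x y
  proof -
    have "cc (\<sigma> x) < cc (\<sigma> y) \<longleftrightarrow> cc (\<sigma>' x) < cc (\<sigma>' y)" using lt[of "ColOf x" "ColOf y"] by simp
    moreover have "cc (\<sigma> y) < cc (\<sigma> x) \<longleftrightarrow> cc (\<sigma>' y) < cc (\<sigma>' x)" using lt[of "ColOf y" "ColOf x"] by simp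
    moreover have "rr (\<sigma> x) < rr (\<sigma> y) \<longleftrightarrow> rr (\<sigma>' x) < rr (\<sigma>' y)" using lt[of "RowOf x" "RowOf y"] by simp
    moreover have "rr (\<sigma> y) < rr (\<sigma> x) \<longleftrightarrow> rr (\<sigma>' y) < rr (\<sigma>' x)" using lt[of "RowOf y" "RowOf x"] by simp
    ultimately show ?thesis unfolding less_iff_coords[of "\<sigma> x"] less_iff_coords[of "\<sigma>' x"] tri_less_def
      by (metis nat_neq_iff)
  qed
  show ?case
  proof (cases "\<exists>x y. xs = [x, y]")
    case True
    then show ?thesis using b atom by (cases P) auto
  next
    case False
    \<comment> \<open>\<open>\<phi>\<close> may be ill-formed; an atom without exactly two arguments
      is false on both sides.\<close>
    then have "map \<tau> xs \<noteq> [a, b]" for \<tau> :: "nat \<Rightarrow> nat" and a b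
      by (auto simp: map_eq_Cons_conv)
    then show ?thesis by (cases P) auto
  qed
next
  case (Conj \<phi> \<psi>)
  have "close (4 ^ qr \<phi>) (coord (Suc m) \<sigma>) (coord (Suc m') \<sigma>')"
    "close (4 ^ qr \<psi>) (coord (Suc m) \<sigma>) (coord (Suc m') \<sigma>')"
    by (rule close_mono[OF Conj.prems(1)]; simp)+
  then show ?case using Conj by simp
next
  case (Ex x \<phi>)
  have pos: "a \<le> q (Suc k) - 1 \<longleftrightarrow> a < q (Suc k)" for a k by (auto simp: q_Suc)
  have c: "close (4 * 4 ^ qr \<phi>) (coord (Suc m) \<sigma>) (coord (Suc m') \<sigma>')" using Ex.prems by simp
  have one: "(1::int) \<le> 4 ^ qr \<phi>" by simp
  show ?case unfolding sat.simps pos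
  proof
    assume "\<exists>a<q (Suc m). sat pred_lt_tri (q (Suc m) - 1) (\<lambda>_. {}) \<phi> (\<sigma>(x := a))"
    then obtain a where a: "a < q (Suc m)" "sat pred_lt_tri (q (Suc m) - 1) (\<lambda>_. {}) \<phi> (\<sigma>(x := a))" by blast
    from close_move[OF c one a(1), of x] obtain a' where
      a': "a' < q (Suc m')" "close (4 ^ qr \<phi>) (coord (Suc m) (\<sigma>(x := a))) (coord (Suc m') (\<sigma>'(x := a')))" by blast
    have "\<forall>v. (\<sigma>(x := a)) v < q (Suc m)" "\<forall>v. (\<sigma>'(x := a')) v < q (Suc m')"
      using Ex.prems a(1) a'(1) by simp_all
    from Ex.IH[OF a'(2) this] a a' show "\<exists>a<q (Suc m'). sat pred_lt_tri (q (Suc m') - 1) (\<lambda>_. {}) \<phi> (\<sigma>'(x := a))" by blast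
  next
    assume "\<exists>a<q (Suc m'). sat pred_lt_tri (q (Suc m') - 1) (\<lambda>_. {}) \<phi> (\<sigma>'(x := a))"
    then obtain a where a: "a < q (Suc m')" "sat pred_lt_tri (q (Suc m') - 1) (\<lambda>_. {}) \<phi> (\<sigma>'(x := a))" by blast
    from close_move[OF close_sym[OF c] one a(1), of x] obtain a' where
      a': "a' < q (Suc m)" "close (4 ^ qr \<phi>) (coord (Suc m') (\<sigma>'(x := a))) (coord (Suc m) (\<sigma>(x := a')))" by blast
    have "\<forall>v. (\<sigma>(x := a')) v < q (Suc m)" "\<forall>v. (\<sigma>'(x := a)) v < q (Suc m')"
      using Ex.prems a(1) a'(1) by simp_all
    from Ex.IH[OF close_sym[OF a'(2)] this] a a' show "\<exists>a<q (Suc m). sat pred_lt_tri (q (Suc m) - 1) (\<lambda>_. {}) \<phi> (\<sigma>(x := a))" by blast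
  qed
qed auto

text \<open>With all variables at 0, the structures differ only in \<open>Top\<close>, which is far
  from 0 in both. As \<open>m\<close> is odd, the additional column has the odd number
  \<open>m + 2\<close> of elements and flips the parity of \<open>n\<close>.\<close>

lemma parity_not_definable:
  fixes \<phi> :: "sym_lt_tri fo"
  shows "\<exists>n. sat pred_lt_tri n (\<lambda>_. {}) \<phi> (\<lambda>_. 0) \<noteq> odd n"
proof (rule ccontr)
  assume "\<not> ?thesis"
  then have *: "sat pred_lt_tri n (\<lambda>_. {}) \<phi> (\<lambda>_. 0) = odd n" for n by blast
  define D where "D = (4::int) ^ qr \<phi>"
  define m where "m = 2 * 4 ^ qr \<phi> + (1::nat)"
  have m: "0 \<le> D" "D \<le> int m" by (simp_all add: D_def m_def)
  have c0: "cc 0 = 0" "rr 0 = 0" using cc_pt[of 0 0] rr_pt[of 0 0] by simp_all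
  have "close D (coord (Suc m) (\<lambda>_. 0)) (coord (Suc (Suc m)) (\<lambda>_. 0))"
    unfolding close_def
  proof (intro allI)
    fix i j
    show "coord (Suc m) (\<lambda>_. 0) i - coord (Suc m) (\<lambda>_. 0) j = coord (Suc (Suc m)) (\<lambda>_. 0) i - coord (Suc (Suc m)) (\<lambda>_. 0) j \<or>
      D \<le> coord (Suc m) (\<lambda>_. 0) i - coord (Suc m) (\<lambda>_. 0) j \<and>
      D \<le> coord (Suc (Suc m)) (\<lambda>_. 0) i - coord (Suc (Suc m)) (\<lambda>_. 0) j \<or>
      coord (Suc m) (\<lambda>_. 0) i - coord (Suc m) (\<lambda>_. 0) j \<le> - D \<and>
      coord (Suc (Suc m)) (\<lambda>_. 0) i - coord (Suc (Suc m)) (\<lambda>_. 0) j \<le> - D"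
      using m by (cases i; cases j) (auto simp: c0)
  qed
  from sat_close[OF this[unfolded D_def]] have "odd (q (Suc m) - 1) = odd (q (Suc (Suc m)) - 1)"
    by (simp add: * q_Suc)
  moreover have "q (Suc (Suc m)) = q (Suc m) + (m + 2)" by (simp add: q_Suc)
  moreover have "odd (m + 2)" by (simp add: m_def)
  ultimately show False by (simp add: q_Suc)
qed

section \<open>Order and addition in FO(Bit)\<close>

definition ok :: "nat \<Rightarrow> (nat \<Rightarrow> nat) \<Rightarrow> bool" where
  "ok n \<sigma> \<longleftrightarrow> (\<forall>v. \<sigma> v \<le> n)"

lemma ok_upd [simp]: "ok n \<sigma> \<Longrightarrow> a \<le> n \<Longrightarrow> ok n (\<sigma>(v := a))"
  by (simp add: ok_def)

lemma okD [simp]: "ok n \<sigma> \<Longrightarrow> \<sigma> v \<le> n"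
  by (simp add: ok_def)

definition "fBit x i = Num BitSym [x, i]"
definition "fAll x \<phi> = Neg (Ex x (Neg \<phi>))"
definition "fOr \<phi> \<psi> = Neg (Conj (Neg \<phi>) (Neg \<psi>))"
definition "fImp \<phi> \<psi> = Neg (Conj \<phi> (Neg \<psi>))"
definition "fIff \<phi> \<psi> = Conj (fImp \<phi> \<psi>) (fImp \<psi> \<phi>)"

lemma wf_connectives [simp]:
  "wf ar ar_bit (fBit x i)"
  "wf ar pa (fAll x \<phi>) = wf ar pa \<phi>"
  "wf ar pa (fOr \<phi> \<psi>) = (wf ar pa \<phi> \<and> wf ar pa \<psi>)"
  "wf ar pa (fImp \<phi> \<psi>) = (wf ar pa \<phi> \<and> wf ar pa \<psi>)"
  "wf ar pa (fIff \<phi> \<psi>) = (wf ar pa \<phi> \<and> wf ar pa \<psi>)"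
  by (auto simp: fBit_def fAll_def fOr_def fImp_def fIff_def ar_bit_def)

lemma sat_connectives [simp]:
  "sat P n I (fAll x \<phi>) \<sigma> \<longleftrightarrow> (\<forall>a\<le>n. sat P n I \<phi> (\<sigma>(x := a)))"
  "sat P n I (fOr \<phi> \<psi>) \<sigma> \<longleftrightarrow> sat P n I \<phi> \<sigma> \<or> sat P n I \<psi> \<sigma>"
  "sat P n I (fImp \<phi> \<psi>) \<sigma> \<longleftrightarrow> (sat P n I \<phi> \<sigma> \<longrightarrow> sat P n I \<psi> \<sigma>)"
  "sat P n I (fIff \<phi> \<psi>) \<sigma> \<longleftrightarrow> (sat P n I \<phi> \<sigma> \<longleftrightarrow> sat P n I \<psi> \<sigma>)"
  by (auto simp: fAll_def fOr_def fImp_def fIff_def)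

abbreviation "satb \<equiv> sat pred_bit"

lemma sat_fBit [simp]: "ok n \<sigma> \<Longrightarrow> satb n I (fBit x i) \<sigma> \<longleftrightarrow> bit (\<sigma> x) (\<sigma> i)"
  by (auto simp: fBit_def Bit_eq_bit)

section \<open>The order on numbers, on bit positions and on the bit positions of these\<close>

definition ltS :: "nat \<Rightarrow> nat \<Rightarrow> nat \<Rightarrow> nat \<Rightarrow> bool" where
  "ltS n S i j \<longleftrightarrow> (\<exists>X\<le>n. bit S X \<and> bit X i \<and> \<not> bit X j)"

text \<open>\<open>R k l\<close> stands for \<open>k < l\<close>; with the true order on positions
  this is the criterion of \<open>nat_less_iff_bit\<close>.\<close>

definition lexless :: "nat \<Rightarrow> (nat \<Rightarrow> nat \<Rightarrow> bool) \<Rightarrow> nat \<Rightarrow> nat \<Rightarrow> bool" where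
  "lexless n R a b \<longleftrightarrow> (\<exists>k\<le>n. bit b k \<and> \<not> bit a k \<and> (\<forall>l\<le>n. R k l \<longrightarrow> (bit a l \<longleftrightarrow> bit b l)))"

definition D2 :: "nat \<Rightarrow> nat \<Rightarrow> bool" where
  "D2 n i \<longleftrightarrow> (\<exists>j\<le>n. \<exists>a\<le>n. bit a j \<and> bit j i)"

text \<open>\<open>S\<close> is a set of initial segments, \<open>ltS n S\<close> the order it codes, and \<open>D2 n\<close> consists of the
  bit positions of bit positions, that is, of the numbers up to about \<open>log (log n)\<close>.\<close>

definition valid :: "nat \<Rightarrow> nat \<Rightarrow> bool" where
  "valid n S \<longleftrightarrow> (\<forall>i\<le>n. \<forall>j\<le>n. D2 n i \<and> D2 n j \<longrightarrow> (ltS n S i j \<longleftrightarrow> lexless n (ltS n S) i j))"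

text \<open>Only one bits of \<open>b\<close> are compared with positions where \<open>a\<close> and
  \<open>b\<close> differ, so \<open>R\<close> may be an order that is right on such positions only,
  as \<open>ltS n S\<close> and \<open>lt1 n\<close> are.\<close>

lemma lexless_eq_less:
  assumes n: "a \<le> n" "b \<le> n"
    and R: "\<And>k l. bit b k \<Longrightarrow> bit a l \<noteq> bit b l \<Longrightarrow> R k l \<longleftrightarrow> k < l"
  shows "lexless n R a b \<longleftrightarrow> a < b"
proof -
  have le: "k \<le> n" if "bit a k \<or> bit b k" for k
    using that bit_imp_less[of a k] bit_imp_less[of b k] n by auto
  have *: "(\<forall>l\<le>n. R k l \<longrightarrow> bit a l = bit b l) \<longleftrightarrow> (\<forall>l>k. bit a l = bit b l)" if "bit b k" for k
    using R[OF that] le by blast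
  have "lexless n R a b \<longleftrightarrow> (\<exists>k. bit b k \<and> \<not> bit a k \<and> (\<forall>l\<le>n. R k l \<longrightarrow> bit a l = bit b l))"
    unfolding lexless_def by (rule ex_cong1) (use le in auto)
  also have "\<dots> \<longleftrightarrow> a < b"
    unfolding nat_less_iff_bit[of a b] by (rule ex_cong1) (use * in auto)
  finally show ?thesis .
qed

lemma D2_le: "D2 n i \<Longrightarrow> i \<le> n"
  unfolding D2_def by (auto dest!: bit_imp_less)

lemma D2_exp: "D2 n i \<Longrightarrow> 2 ^ (2 ^ i) \<le> n"
proof -
  assume "D2 n i"
  then obtain j a where "a \<le> n" "2 ^ j \<le> a" "2 ^ i \<le> j" unfolding D2_def using bit_imp_exp_le by blast
  moreover then have "(2::nat) ^ (2 ^ i) \<le> 2 ^ j" by (intro power_increasing) auto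
  ultimately show ?thesis by linarith
qed

text \<open>Together with \<open>D2_exp\<close> this makes \<open>D2 n\<close> the initial segment
  of all \<open>i\<close> with \<open>2 ^ (2 ^ i) \<le> n\<close>.\<close>

lemma D2I: "2 ^ (2 ^ i) \<le> n \<Longrightarrow> D2 n i"
proof -
  assume n: "2 ^ (2 ^ i) \<le> n"
  have "2 ^ i \<le> n" using n less_exp[of "2 ^ i"] by linarith
  moreover have "bit (2 ^ (2 ^ i) :: nat) (2 ^ i)" "bit (2 ^ i :: nat) i" by (simp_all add: bit_exp_iff)
  ultimately show ?thesis unfolding D2_def using n by blast
qed

lemma D2_down:
  assumes "D2 n i" "k \<le> i"
  shows "D2 n k"
proof -
  have "(2::nat) ^ (2 ^ k) \<le> 2 ^ (2 ^ i)" using assms(2) by (intro power_increasing) auto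
  then show ?thesis using D2_exp[OF assms(1)] by (intro D2I) linarith
qed

text \<open>The recursion in \<open>valid\<close> has only one solution: bit positions of a number
  are smaller than the number, so comparing \<open>i\<close> and \<open>j\<close> refers only to
  pairs with a smaller maximum.\<close>

lemma valid_ltS:
  assumes "valid n S"
  shows "D2 n i \<Longrightarrow> D2 n j \<Longrightarrow> ltS n S i j \<longleftrightarrow> i < j"
proof (induction "max i j" arbitrary: i j rule: less_induct)
  case less
  have le: "i \<le> n" "j \<le> n" using less.prems D2_le by auto
  then have "ltS n S i j \<longleftrightarrow> lexless n (ltS n S) i j"
    using assms less.prems by (simp add: valid_def)
  also have "\<dots> \<longleftrightarrow> i < j"
  proof (rule lexless_eq_less[OF le])
    fix k l assume kl: "bit j k" "bit i l \<noteq> bit j l"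
    then have "k < j" "l < i \<or> l < j" using bit_imp_less by blast+
    then have "max k l < max i j" "D2 n k" "D2 n l"
      using less.prems D2_down less_imp_le by (auto simp: less_max_iff_disj)
    then show "ltS n S k l \<longleftrightarrow> k < l" using less.hyps by blast
  qed
  finally show ?case .
qed

text \<open>\<open>S\<close> is the set of all initial segments \<open>mask k\<close> with
  \<open>k \<le> M\<close>, where \<open>M\<close> is the largest element of \<open>D2 n\<close>.
  They are below \<open>2 ^ M\<close>, hence \<open>S < 2 ^ (2 ^ M) \<le> n\<close>.\<close>

lemma ex_valid: "\<exists>S\<le>n. valid n S"
proof (cases "\<exists>i. D2 n i")
  case False
  then show ?thesis by (intro exI[of _ 0]) (simp add: valid_def)
next
  case True
  define M where "M = (GREATEST i. D2 n i)"
  from True obtain i0 where "D2 n i0" ..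
  then have DM: "D2 n M" unfolding M_def using D2_le GreatestI_nat[of "D2 n" i0 n] by blast
  have M: "i \<le> M" if "D2 n i" for i
    unfolding M_def using that D2_le Greatest_le_nat[of "D2 n" i n] by blast
  obtain S :: nat where S: "S < 2 ^ (2 ^ M)" "\<And>X. bit S X \<longleftrightarrow> X < 2 ^ M \<and> (\<exists>k\<le>M. X = mask k)"
    using bit_comprehension[of "2 ^ M" "\<lambda>X. \<exists>k\<le>M. X = mask k"] by blast
  have Sn: "S \<le> n" using S(1) D2_exp[OF DM] by linarith
  have lt: "ltS n S i j \<longleftrightarrow> i < j" if "D2 n i" "D2 n j" for i j
  proof
    assume "ltS n S i j"
    then obtain X where X: "bit S X" "bit X i" "\<not> bit X j" unfolding ltS_def by blast
    from X(1) obtain k where k: "X = mask k" unfolding S(2) by blast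
    show "i < j" using X(2,3) unfolding k by (simp add: bit_mask_iff)
  next
    assume ij: "i < j"
    have "(2::nat) ^ j \<le> 2 ^ M" using M[OF that(2)] by (intro power_increasing) auto
    then have "mask j < (2::nat) ^ M" using mask_nat_less_exp[of j] by linarith
    then have bS: "bit S (mask j)" unfolding S(2) using M[OF that(2)] by blast
    then have "mask j < S" by (rule bit_imp_less)
    then have "mask j \<le> n" using Sn by linarith
    then show "ltS n S i j" unfolding ltS_def using bS ij
      by (intro exI[of _ "mask j"] conjI) (simp_all add: bit_mask_iff)
  qed
  have "valid n S"
    unfolding valid_def
  proof (intro allI impI, elim conjE)
    fix i j assume ij: "D2 n i" "D2 n j"
    have "lexless n (ltS n S) i j \<longleftrightarrow> i < j"
    proof (rule lexless_eq_less)
      fix k l assume kl: "bit j k" "bit i l \<noteq> bit j l"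
      then have "k < j" "l < i \<or> l < j" using bit_imp_less by blast+
      then have "D2 n k" "D2 n l" using D2_down[OF ij(1), of l] D2_down[OF ij(2)] by auto
      then show "ltS n S k l \<longleftrightarrow> k < l" by (rule lt)
    qed (use ij D2_le in auto)
    then show "ltS n S i j \<longleftrightarrow> lexless n (ltS n S) i j" using lt[OF ij] by simp
  qed
  then show ?thesis using Sn by blast
qed

definition lt1 :: "nat \<Rightarrow> nat \<Rightarrow> nat \<Rightarrow> bool" where
  "lt1 n i j \<longleftrightarrow> (\<exists>S\<le>n. valid n S \<and> lexless n (ltS n S) i j)"

text \<open>The bit positions of \<open>i\<close> and \<open>j\<close> satisfy \<open>D2 n\<close>,
  where every valid \<open>S\<close> codes the true order, and a valid \<open>S\<close>
  exists.\<close>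

lemma lt1_iff:
  assumes "a \<le> n" "b \<le> n" "bit a i" "bit b j"
  shows "lt1 n i j \<longleftrightarrow> i < j"
proof -
  have le: "i \<le> n" "j \<le> n" using assms bit_imp_less by (metis le_trans less_imp_le)+
  have "lexless n (ltS n S) i j \<longleftrightarrow> i < j" if "valid n S" for S
  proof (rule lexless_eq_less[OF le])
    fix k l assume kl: "bit j k" "bit i l \<noteq> bit j l"
    have D: "D2 n x" if "bit i x \<or> bit j x" for x using that assms le by (auto simp: D2_def)
    show "ltS n S k l \<longleftrightarrow> k < l" using kl D valid_ltS[OF that] by metis
  qed
  then show ?thesis using ex_valid[of n] by (auto simp: lt1_def)
qed

lemma lexless_lt1: "a \<le> n \<Longrightarrow> b \<le> n \<Longrightarrow> lexless n (lt1 n) a b \<longleftrightarrow> a < b"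
  by (rule lexless_eq_less) (use lt1_iff in blast)+

text \<open>Variable convention for all formula constructors: the arguments are smaller than \<open>m\<close>, and the
  bound variables are at least \<open>m\<close>.\<close>

definition "fLtS S m i j = Ex m (Conj (fBit S m) (Conj (fBit m i) (Neg (fBit m j))))"

definition "fLex F m x y = Ex m (Conj (fBit y m) (Conj (Neg (fBit x m))
   (fAll (m+1) (fImp (F (m+2) m (m+1)) (fIff (fBit x (m+1)) (fBit y (m+1)))))))"

definition "fD2 m i = Ex m (Ex (m+1) (Conj (fBit (m+1) m) (fBit m i)))"

definition "fValid m S = fAll m (fAll (m+1) (fImp (Conj (fD2 (m+2) m) (fD2 (m+2) (m+1)))
   (fIff (fLtS S (m+2) m (m+1)) (fLex (fLtS S) (m+2) m (m+1)))))"

definition "fLt1 m i j = Ex m (Conj (fValid (m+1) m) (fLex (fLtS m) (m+1) i j))"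

definition "fLess m x y = fLex fLt1 m x y"

lemma sat_fLtS [simp]:
  "ok n \<sigma> \<Longrightarrow> S < m \<Longrightarrow> i < m \<Longrightarrow> j < m \<Longrightarrow> satb n I (fLtS S m i j) \<sigma> \<longleftrightarrow> ltS n (\<sigma> S) (\<sigma> i) (\<sigma> j)"
  by (simp add: fLtS_def ltS_def cong: conj_cong)

lemma sat_fLex:
  assumes "ok n \<sigma>" "x < m" "y < m"
    and "\<And>k l. k \<le> n \<Longrightarrow> l \<le> n \<Longrightarrow> satb n I (F (m+2) m (m+1)) (\<sigma>(m := k, m+1 := l)) \<longleftrightarrow> R k l"
  shows "satb n I (fLex F m x y) \<sigma> \<longleftrightarrow> lexless n R (\<sigma> x) (\<sigma> y)"
  using assms by (simp add: fLex_def lexless_def cong: conj_cong)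

lemma sat_fD2 [simp]: "ok n \<sigma> \<Longrightarrow> i < m \<Longrightarrow> satb n I (fD2 m i) \<sigma> \<longleftrightarrow> D2 n (\<sigma> i)"
  by (simp add: fD2_def D2_def cong: conj_cong)

lemma sat_fValid [simp]: "ok n \<sigma> \<Longrightarrow> S < m \<Longrightarrow> satb n I (fValid m S) \<sigma> \<longleftrightarrow> valid n (\<sigma> S)"
  by (simp add: fValid_def valid_def sat_fLex[where R = "ltS n (\<sigma> S)"] cong: conj_cong)

lemma sat_fLt1 [simp]:
  "ok n \<sigma> \<Longrightarrow> i < m \<Longrightarrow> j < m \<Longrightarrow> satb n I (fLt1 m i j) \<sigma> \<longleftrightarrow> lt1 n (\<sigma> i) (\<sigma> j)"
proof -
  assume a: "ok n \<sigma>" "i < m" "j < m"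
  have "satb n I (fLex (fLtS m) (m+1) i j) (\<sigma>(m := S)) \<longleftrightarrow> lexless n (ltS n S) (\<sigma> i) (\<sigma> j)" if "S \<le> n" for S
    using sat_fLex[of n "\<sigma>(m := S)" i "m+1" j I "fLtS m" "ltS n S"] a that by simp
  then show ?thesis using a by (simp add: fLt1_def lt1_def cong: conj_cong)
qed

lemma sat_fLess [simp]:
  "ok n \<sigma> \<Longrightarrow> x < m \<Longrightarrow> y < m \<Longrightarrow> satb n I (fLess m x y) \<sigma> \<longleftrightarrow> \<sigma> x < \<sigma> y"
  by (simp add: fLess_def sat_fLex[where R = "lt1 n"] lexless_lt1)

lemma wf_fLess [simp]: "wf ar ar_bit (fLess m x y)"
  by (simp add: fLess_def fLex_def fLt1_def fValid_def fD2_def fLtS_def)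

section \<open>Addition\<close>

definition "fCarry m x y i = Ex m (Conj (fLess (m+1) m i) (Conj (fBit x m) (Conj (fBit y m)
   (fAll (m+1) (fImp (Conj (fLess (m+2) m (m+1)) (fLess (m+2) (m+1) i)) (fOr (fBit x (m+1)) (fBit y (m+1))))))))"

definition "fAdd m x y z = fAll m (fIff (fBit z m)
   (Neg (fIff (fBit x m) (Neg (fIff (fBit y m) (fCarry (m+1) x y m))))))"

lemma wf_fAdd [simp]: "wf ar ar_bit (fAdd m x y z)"
  by (simp add: fAdd_def fCarry_def)

lemma sat_fCarry [simp]:
  "ok n \<sigma> \<Longrightarrow> x < m \<Longrightarrow> y < m \<Longrightarrow> i < m \<Longrightarrow> satb n I (fCarry m x y i) \<sigma> \<longleftrightarrow> carry (\<sigma> x) (\<sigma> y) (\<sigma> i)"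
proof -
  assume a: "ok n \<sigma>" "x < m" "y < m" "i < m"
  have "satb n I (fCarry m x y i) \<sigma> \<longleftrightarrow> (\<exists>j\<le>n. j < \<sigma> i \<and> bit (\<sigma> x) j \<and> bit (\<sigma> y) j \<and>
     (\<forall>k\<le>n. j < k \<and> k < \<sigma> i \<longrightarrow> bit (\<sigma> x) k \<or> bit (\<sigma> y) k))"
    using a by (simp add: fCarry_def cong: conj_cong)
  also have "\<dots> \<longleftrightarrow> carry (\<sigma> x) (\<sigma> y) (\<sigma> i)"
  proof -
    have "k \<le> n" if "k < \<sigma> i" for k using okD[OF a(1), of i] that by linarith
    then show ?thesis unfolding carry_def by blast
  qed
  finally show ?thesis .
qed

lemma nat_eq_bits_le:
  fixes a b :: nat
  assumes "a < 2 ^ Suc n" "b < 2 ^ Suc n"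
  shows "(\<forall>i\<le>n. bit a i \<longleftrightarrow> bit b i) \<longleftrightarrow> a = b"
proof
  assume *: "\<forall>i\<le>n. bit a i \<longleftrightarrow> bit b i"
  show "a = b"
  proof (rule bit_eqI)
    fix i show "bit a i \<longleftrightarrow> bit b i"
      using * bit_of_less_exp[OF assms(1), of i] bit_of_less_exp[OF assms(2), of i]
      by (cases "i \<le> n") (auto simp only: less_Suc_eq_le)
  qed
qed simp

lemma le_imp_less_exp: "(a::nat) \<le> 2 * n \<Longrightarrow> a < 2 ^ Suc n"
  using less_exp[of n] unfolding power_Suc by linarith

lemma sat_fAdd [simp]:
  "ok n \<sigma> \<Longrightarrow> x < m \<Longrightarrow> y < m \<Longrightarrow> z < m \<Longrightarrow> satb n I (fAdd m x y z) \<sigma> \<longleftrightarrow> \<sigma> z = \<sigma> x + \<sigma> y"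
proof -
  assume a: "ok n \<sigma>" "x < m" "y < m" "z < m"
  have "satb n I (fAdd m x y z) \<sigma> \<longleftrightarrow> (\<forall>i\<le>n. bit (\<sigma> z) i \<longleftrightarrow> bit (\<sigma> x + \<sigma> y) i)"
    using a by (simp add: fAdd_def bit_add_carry)
  also have "\<dots> \<longleftrightarrow> \<sigma> z = \<sigma> x + \<sigma> y"
    \<comment> \<open>The sum may exceed \<open>n\<close>, but it is at most
      \<open>2 * n < 2 ^ Suc n\<close>, so the bits up to position \<open>n\<close> still determine
      it.\<close>
    using okD[OF a(1), of x] okD[OF a(1), of y] okD[OF a(1), of z]
    by (intro nat_eq_bits_le le_imp_less_exp) linarith+
  finally show ?thesis .
qed

section \<open>Multiplication in FO(Bit)\<close>

definition "fZero m x = fAll m (Neg (fBit x m))"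
definition "fDrop m p x y = fAll m (fIff (fBit y m) (Ex (m+1) (Conj (fAdd (m+2) m p (m+1)) (fBit x (m+1)))))"
definition "fWin m W p x y = fAll m (fIff (fBit y m)
   (Conj (fLess (m+1) m W) (Ex (m+1) (Conj (fAdd (m+2) m p (m+1)) (fBit x (m+1))))))"
text \<open>\<open>f\<close> is an exponent: as the window width is \<open>W = 2 ^ f\<close>,
  divisibility by \<open>W\<close> is a condition on low bits and division by \<open>W\<close> is a
  shift.\<close>

definition "fDvd m f p = fAll m (fImp (fBit p m) (Neg (fLess (m+1) m f)))"
text \<open>Multiplication by a power of two, stated as a shift of \<open>y\<close> back to
  \<open>x\<close> that loses no bits.\<close>

definition "fPush m h x y = Conj (fDrop m h y x) (fDvd m h y)"

lemma wf_arith [simp]: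
  "wf ar ar_bit (fZero m x)" "wf ar ar_bit (fDrop m p x y)" "wf ar ar_bit (fWin m W p x y)"
  "wf ar ar_bit (fDvd m f p)" "wf ar ar_bit (fPush m h x y)"
  by (simp_all add: fZero_def fDrop_def fWin_def fDvd_def fPush_def)

lemma nat_eq_bits:
  assumes "a \<le> n" "b \<le> n"
  shows "(\<forall>i\<le>n. bit a i \<longleftrightarrow> bit b i) \<longleftrightarrow> a = b"
  using assms by (intro nat_eq_bits_le le_imp_less_exp) linarith+

lemma ex_bit_shift: "x \<le> n \<Longrightarrow> (\<exists>j\<le>n. j = i + p \<and> bit x j) \<longleftrightarrow> bit x (i + p)"
  using bit_imp_less[of x "i + p"] by auto

lemma sat_fZero [simp]: "ok n \<sigma> \<Longrightarrow> x < m \<Longrightarrow> satb n I (fZero m x) \<sigma> \<longleftrightarrow> \<sigma> x = 0"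
  using nat_eq_bits[of "\<sigma> x" n 0] by (simp add: fZero_def)

lemma sat_fDrop [simp]:
  assumes "ok n \<sigma>" "p < m" "x < m" "y < m"
  shows "satb n I (fDrop m p x y) \<sigma> \<longleftrightarrow> \<sigma> y = drop_bit (\<sigma> p) (\<sigma> x)"
proof -
  have "satb n I (fDrop m p x y) \<sigma> \<longleftrightarrow> (\<forall>i\<le>n. bit (\<sigma> y) i \<longleftrightarrow> (\<exists>j\<le>n. j = i + \<sigma> p \<and> bit (\<sigma> x) j))"
    using assms by (simp add: fDrop_def cong: conj_cong)
  also have "\<dots> \<longleftrightarrow> (\<forall>i\<le>n. bit (\<sigma> y) i \<longleftrightarrow> bit (drop_bit (\<sigma> p) (\<sigma> x)) i)"
    using assms(1) by (simp add: ex_bit_shift bit_drop_bit_eq add.commute)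
  also have "\<dots> \<longleftrightarrow> \<sigma> y = drop_bit (\<sigma> p) (\<sigma> x)"
  proof (rule nat_eq_bits)
    have "drop_bit (\<sigma> p) (\<sigma> x) \<le> \<sigma> x" by (simp add: drop_bit_eq_div)
    then show "drop_bit (\<sigma> p) (\<sigma> x) \<le> n" using okD[OF assms(1), of x] by linarith
  qed (use assms in simp)
  finally show ?thesis .
qed

lemma sat_fWin [simp]:
  assumes "ok n \<sigma>" "W < m" "p < m" "x < m" "y < m"
  shows "satb n I (fWin m W p x y) \<sigma> \<longleftrightarrow> \<sigma> y = win (\<sigma> W) (\<sigma> p) (\<sigma> x)"
proof -
  have "satb n I (fWin m W p x y) \<sigma> \<longleftrightarrow>
     (\<forall>i\<le>n. bit (\<sigma> y) i \<longleftrightarrow> i < \<sigma> W \<and> (\<exists>j\<le>n. j = i + \<sigma> p \<and> bit (\<sigma> x) j))"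
    using assms by (simp add: fWin_def cong: conj_cong)
  also have "\<dots> \<longleftrightarrow> (\<forall>i\<le>n. bit (\<sigma> y) i \<longleftrightarrow> bit (win (\<sigma> W) (\<sigma> p) (\<sigma> x)) i)"
    using assms(1) by (simp add: ex_bit_shift bit_win)
  also have "\<dots> \<longleftrightarrow> \<sigma> y = win (\<sigma> W) (\<sigma> p) (\<sigma> x)"
    using win_le[of "\<sigma> W" "\<sigma> p" "\<sigma> x"] okD[OF assms(1), of x] okD[OF assms(1), of y]
    by (intro nat_eq_bits) linarith+
  finally show ?thesis .
qed

lemma exp_dvd_iff_bit: "2 ^ f dvd (p::nat) \<longleftrightarrow> (\<forall>i. bit p i \<longrightarrow> \<not> i < f)"
proof -
  have "2 ^ f dvd p \<longleftrightarrow> take_bit f p = 0" by (simp add: take_bit_eq_0_iff)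
  also have "\<dots> \<longleftrightarrow> (\<forall>i. bit p i \<longrightarrow> \<not> i < f)" by (auto simp: bit_eq_iff bit_take_bit_iff)
  finally show ?thesis .
qed

lemma sat_fDvd [simp]:
  assumes "ok n \<sigma>" "f < m" "p < m"
  shows "satb n I (fDvd m f p) \<sigma> \<longleftrightarrow> 2 ^ \<sigma> f dvd \<sigma> p"
proof -
  have "i \<le> n" if "bit (\<sigma> p) i" for i using bit_imp_less[OF that] okD[OF assms(1), of p] by linarith
  then show ?thesis unfolding exp_dvd_iff_bit using assms by (auto simp: fDvd_def)
qed

lemma sat_fPush [simp]:
  assumes "ok n \<sigma>" "h < m" "x < m" "y < m"
  shows "satb n I (fPush m h x y) \<sigma> \<longleftrightarrow> \<sigma> y = \<sigma> x * 2 ^ \<sigma> h"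
  using assms by (auto simp: fPush_def drop_bit_eq_div)

text \<open>Variable \<open>m + 1\<close> holds \<open>S\<close> shifted down by one window, because
  the position \<open>p + W\<close> of the next window may lie outside the universe.\<close>

definition "fIsum F m W f v = Ex m (Conj (Ex (m+1) (Conj (fZero (m+2) (m+1)) (fWin (m+2) W (m+1) m v)))
   (Ex (m+1) (Conj (fDrop (m+2) W m (m+1)) (fAll (m+2) (fImp (fDvd (m+3) f (m+2)) (Ex (m+3) (Conj (F (m+4) (m+2) (m+3))
     (Ex (m+4) (Ex (m+5) (Conj (fWin (m+6) W (m+2) m (m+4)) (Conj (fWin (m+6) W (m+2) (m+1) (m+5))
       (fAdd (m+6) (m+5) (m+3) (m+4)))))))))))))"

lemma wf_fIsum [simp]: "(\<And>m p t. wf ar ar_bit (F m p t)) \<Longrightarrow> wf ar ar_bit (fIsum F m W f v)"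
  by (simp add: fIsum_def)

lemma sat_fIsum:
  assumes ok: "ok n \<sigma>" and lt: "W < m" "f < m" "v < m" and W: "\<sigma> W = 2 ^ \<sigma> f"
    and F: "\<And>S S' p t. S \<le> n \<Longrightarrow> S' \<le> n \<Longrightarrow> p \<le> n \<Longrightarrow> t \<le> n \<Longrightarrow>
      satb n I (F (m+4) (m+2) (m+3)) (\<sigma>(m := S, m+1 := S', m+2 := p, m+3 := t)) \<longleftrightarrow> T p t"
  shows "satb n I (fIsum F m W f v) \<sigma> \<longleftrightarrow> isum n (\<sigma> W) T (\<sigma> v)"
proof -
  have le: "win w p x \<le> n" if "x \<le> n" for w p x using win_le[of w p x] that by linarith
  have dle: "drop_bit w x \<le> n" if "x \<le> n" for w x :: nat
    using that by (simp add: drop_bit_eq_div) (meson div_le_dividend le_trans)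
  have "satb n I (fIsum F m W f v) \<sigma> \<longleftrightarrow> (\<exists>S\<le>n. (\<exists>z\<le>n. z = 0 \<and> \<sigma> v = win (\<sigma> W) z S) \<and>
     (\<exists>S'\<le>n. S' = drop_bit (\<sigma> W) S \<and> (\<forall>p\<le>n. 2 ^ \<sigma> f dvd p \<longrightarrow> (\<exists>t\<le>n. T p t \<and>
       (\<exists>u\<le>n. \<exists>u'\<le>n. u = win (\<sigma> W) p S \<and> u' = win (\<sigma> W) p S' \<and> u = u' + t)))))"
    using ok lt F by (simp add: fIsum_def cong: conj_cong)
  also have "\<dots> \<longleftrightarrow> isum n (\<sigma> W) T (\<sigma> v)"
    unfolding isum_def win_add W[symmetric]
    by (simp add: le dle cong: conj_cong)
  finally show ?thesis .
qed

definition "fDmul m W f \<alpha> \<beta> \<gamma> = fIsum (\<lambda>m p t. Ex m (Conj (fDrop (m+1) f p m)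
   (fOr (Conj (fBit \<alpha> m) (fPush (m+1) m \<beta> t)) (Conj (Neg (fBit \<alpha> m)) (fZero (m+1) t))))) m W f \<gamma>"

definition "fCol m W f A B K v = fIsum (\<lambda>m p t. fOr (Ex m (Conj (fAdd (m+1) m p K) (Ex (m+1) (Ex (m+2)
   (Conj (fWin (m+3) W p A (m+1)) (Conj (fWin (m+3) W m B (m+2)) (fDmul (m+3) W f (m+1) (m+2) t)))))))
   (Conj (fLess m K p) (fZero m t))) m W f v"

definition "fSmul W f m A B P = fAll m (fImp (fDvd (m+1) f m) (Ex (m+1) (Conj (fWin (m+2) W m P (m+1))
   (fCol (m+2) W f A B m (m+1)))))"

lemma wf_fSmul [simp]: "wf ar ar_bit (fSmul W f m A B P)"
  by (simp add: fSmul_def fCol_def fDmul_def)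

lemma sat_fDmul [simp]:
  assumes "ok n \<sigma>" "W < m" "f < m" "\<alpha> < m" "\<beta> < m" "\<gamma> < m" and W: "\<sigma> W = 2 ^ \<sigma> f"
  shows "satb n I (fDmul m W f \<alpha> \<beta> \<gamma>) \<sigma> \<longleftrightarrow> dmul n (\<sigma> W) (\<sigma> \<alpha>) (\<sigma> \<beta>) (\<sigma> \<gamma>)"
  unfolding fDmul_def dmul_def
proof (rule sat_fIsum)
  fix S S' p t assume le: "S \<le> n" "S' \<le> n" "p \<le> n" "t \<le> n"
  have d: "p div \<sigma> W \<le> n" using le(3) by (meson div_le_dividend le_trans)
  show "satb n I (Ex (m+4) (Conj (fDrop (m+4+1) f (m+2) (m+4))
     (fOr (Conj (fBit \<alpha> (m+4)) (fPush (m+4+1) (m+4) \<beta> (m+3))) (Conj (Neg (fBit \<alpha> (m+4))) (fZero (m+4+1) (m+3))))))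
     (\<sigma>(m := S, m+1 := S', m+2 := p, m+3 := t)) \<longleftrightarrow>
     (if bit (\<sigma> \<alpha>) (p div \<sigma> W) then t = \<sigma> \<beta> * 2 ^ (p div \<sigma> W) else t = 0)"
    using assms(1-6) le d by (auto simp: drop_bit_eq_div W cong: conj_cong)
qed (use assms in simp_all)

lemma sat_fCol [simp]:
  assumes "ok n \<sigma>" "W < m" "f < m" "A < m" "B < m" "K < m" "v < m" and W: "\<sigma> W = 2 ^ \<sigma> f"
  shows "satb n I (fCol m W f A B K v) \<sigma> \<longleftrightarrow> col n (\<sigma> W) (\<sigma> A) (\<sigma> B) (\<sigma> K) (\<sigma> v)"
  unfolding fCol_def col_def
proof (rule sat_fIsum)
  fix S S' p t assume le: "S \<le> n" "S' \<le> n" "p \<le> n" "t \<le> n"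
  have wle: "win w p x \<le> n" if "x \<le> n" for w p x using win_le[of w p x] that by linarith
  have "satb n I (fOr (Ex (m+4) (Conj (fAdd (m+4+1) (m+4) (m+2) K) (Ex (m+4+1) (Ex (m+4+2)
     (Conj (fWin (m+4+3) W (m+2) A (m+4+1)) (Conj (fWin (m+4+3) W (m+4) B (m+4+2)) (fDmul (m+4+3) W f (m+4+1) (m+4+2) (m+3))))))))
     (Conj (fLess (m+4) K (m+2)) (fZero (m+4) (m+3)))) (\<sigma>(m := S, m+1 := S', m+2 := p, m+3 := t)) \<longleftrightarrow>
     (\<exists>d\<le>n. \<sigma> K = d + p \<and> (\<exists>a\<le>n. \<exists>b\<le>n. a = win (\<sigma> W) p (\<sigma> A) \<and> b = win (\<sigma> W) d (\<sigma> B) \<and> dmul n (\<sigma> W) a b t))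
     \<or> \<sigma> K < p \<and> t = 0"
    using assms le by (simp cong: conj_cong)
  also have "\<dots> \<longleftrightarrow> (if p \<le> \<sigma> K then dmul n (\<sigma> W) (win (\<sigma> W) p (\<sigma> A)) (win (\<sigma> W) (\<sigma> K - p) (\<sigma> B)) t else t = 0)"
  proof (cases "p \<le> \<sigma> K")
    case True
    have "\<sigma> K - p \<le> n" using okD[OF assms(1), of K] by linarith
    moreover have "\<sigma> K = d + p \<longleftrightarrow> d = \<sigma> K - p" for d using True by auto
    ultimately show ?thesis using True wle assms(1) by (simp cong: conj_cong)
  qed auto
  finally show "satb n I (fOr (Ex (m+4) (Conj (fAdd (m+4+1) (m+4) (m+2) K) (Ex (m+4+1) (Ex (m+4+2)
     (Conj (fWin (m+4+3) W (m+2) A (m+4+1)) (Conj (fWin (m+4+3) W (m+4) B (m+4+2)) (fDmul (m+4+3) W f (m+4+1) (m+4+2) (m+3))))))))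
     (Conj (fLess (m+4) K (m+2)) (fZero (m+4) (m+3)))) (\<sigma>(m := S, m+1 := S', m+2 := p, m+3 := t)) \<longleftrightarrow>
     (if p \<le> \<sigma> K then dmul n (\<sigma> W) (win (\<sigma> W) p (\<sigma> A)) (win (\<sigma> W) (\<sigma> K - p) (\<sigma> B)) t else t = 0)" .
qed (use assms in simp_all)

section \<open>Multiplication of arbitrary factors\<close>

text \<open>The contract that the nested constructors pass on: the variables \<open>W\<close> and
  \<open>f\<close> hold the window width and its exponent, and lie below all bound
  variables.\<close>

definition expresses :: "nat \<Rightarrow> (nat \<Rightarrow> nat list set) \<Rightarrow> nat \<Rightarrow> nat \<Rightarrow> nat \<Rightarrow>
    (nat \<Rightarrow> nat \<Rightarrow> nat \<Rightarrow> nat \<Rightarrow> sym_bit fo) \<Rightarrow> (nat \<Rightarrow> nat \<Rightarrow> nat \<Rightarrow> bool) \<Rightarrow> bool" where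
  "expresses n I W f e F M \<longleftrightarrow> (\<forall>m a b x \<sigma>. ok n \<sigma> \<longrightarrow> W < m \<longrightarrow> f < m \<longrightarrow> a < m \<longrightarrow> b < m \<longrightarrow> x < m \<longrightarrow>
     \<sigma> W = 2 ^ e \<longrightarrow> \<sigma> f = e \<longrightarrow> (satb n I (F m a b x) \<sigma> \<longleftrightarrow> M (\<sigma> a) (\<sigma> b) (\<sigma> x)))"

lemma expresses_fSmul: "expresses n I W f e (fSmul W f) (smul n (2 ^ e))"
  unfolding expresses_def
proof (intro allI impI)
  fix m a b x \<sigma> assume a: "ok n \<sigma>" "W < m" "f < m" "a < m" "b < m" "x < m" "\<sigma> W = 2 ^ e" "\<sigma> f = e"
  have wle: "win w p x \<le> n" if "x \<le> n" for w p x using win_le[of w p x] that by linarith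
  have "satb n I (fSmul W f m a b x) \<sigma> \<longleftrightarrow> (\<forall>K\<le>n. 2 ^ e dvd K \<longrightarrow> (\<exists>v\<le>n. v = win (2 ^ e) K (\<sigma> x) \<and>
      col n (2 ^ e) (\<sigma> a) (\<sigma> b) K v))"
    using a by (simp add: fSmul_def cong: conj_cong)
  also have "\<dots> \<longleftrightarrow> smul n (2 ^ e) (\<sigma> a) (\<sigma> b) (\<sigma> x)"
    unfolding smul_def using wle a(1) by (simp cong: conj_cong)
  finally show "satb n I (fSmul W f m a b x) \<sigma> \<longleftrightarrow> smul n (2 ^ e) (\<sigma> a) (\<sigma> b) (\<sigma> x)" .
qed

definition "fDistr F m a b x = Ex m (Ex (m+1) (Ex (m+2) (Ex (m+3) (Ex (m+4)
   (Conj (Ex (m+5) (Conj (fPush (m+6) m (m+2) (m+5)) (fAdd (m+6) (m+1) (m+5) a)))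
   (Conj (Ex (m+5) (Conj (fPush (m+6) m (m+4) (m+5)) (fAdd (m+6) (m+3) (m+5) x)))
   (Conj (F (m+5) (m+1) b (m+3)) (F (m+5) (m+2) b (m+4)))))))))"

definition "fDistr' F m a b x = fDistr (\<lambda>m b a. F m a b) m b a x"

lemma wf_fDistr [simp]:
  "(\<And>m a b x. wf ar ar_bit (F m a b x)) \<Longrightarrow> wf ar ar_bit (fDistr F m a b x)"
  "(\<And>m a b x. wf ar ar_bit (F m a b x)) \<Longrightarrow> wf ar ar_bit (fDistr' F m a b x)"
  by (simp_all add: fDistr_def fDistr'_def)

lemma expresses_fDistr:
  assumes "expresses n I W f e F M"
  shows "expresses n I W f e (fDistr F) (distr n M)"
  unfolding expresses_def
proof (intro allI impI)
  fix m a b x \<sigma> assume a: "ok n \<sigma>" "W < m" "f < m" "a < m" "b < m" "x < m" "\<sigma> W = 2 ^ e" "\<sigma> f = e"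
  have F: "satb n I (F m a b x) \<sigma> \<longleftrightarrow> M (\<sigma> a) (\<sigma> b) (\<sigma> x)"
    if "ok n \<sigma>" "W < m" "f < m" "a < m" "b < m" "x < m" "\<sigma> W = 2 ^ e" "\<sigma> f = e" for m a b x \<sigma>
    using assms that by (simp add: expresses_def)
  have "satb n I (fDistr F m a b x) \<sigma> \<longleftrightarrow> (\<exists>h\<le>n. \<exists>a1\<le>n. \<exists>a2\<le>n. \<exists>x1\<le>n. \<exists>x2\<le>n.
     (\<exists>c\<le>n. c = a2 * 2 ^ h \<and> \<sigma> a = a1 + c) \<and> (\<exists>c\<le>n. c = x2 * 2 ^ h \<and> \<sigma> x = x1 + c) \<and>
     M a1 (\<sigma> b) x1 \<and> M a2 (\<sigma> b) x2)"
    using a by (simp add: fDistr_def F cong: conj_cong)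
  also have "\<dots> \<longleftrightarrow> distr n M (\<sigma> a) (\<sigma> b) (\<sigma> x)"
  proof -
    have "(\<exists>c\<le>n. c = d \<and> \<sigma> y = e + c) \<longleftrightarrow> \<sigma> y = e + d" for y d e
      using okD[OF a(1), of y] by auto
    then show ?thesis by (simp only: distr_def)
  qed
  finally show "satb n I (fDistr F m a b x) \<sigma> \<longleftrightarrow> distr n M (\<sigma> a) (\<sigma> b) (\<sigma> x)" .
qed

lemma expresses_fDistr':
  assumes "expresses n I W f e F M"
  shows "expresses n I W f e (fDistr' F) (distr' n M)"
proof -
  have "expresses n I W f e (\<lambda>m b a. F m a b) (\<lambda>b a. M a b)"
    using assms by (simp add: expresses_def)
  from expresses_fDistr[OF this] show ?thesis
    by (simp add: expresses_def fDistr'_def distr'_def)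
qed

definition "fMul W f = fDistr (fDistr (fDistr' (fDistr' (fSmul W f))))"

lemma wf_fMul [simp]: "wf ar ar_bit (fMul W f m a b x)"
  by (simp add: fMul_def)

lemma sat_fMul [simp]:
  assumes "ok n \<sigma>" "W < m" "f < m" "a < m" "b < m" "x < m" "\<sigma> W = 2 ^ \<sigma> f"
  shows "satb n I (fMul W f m a b x) \<sigma> \<longleftrightarrow> wmul n (\<sigma> W) (\<sigma> a) (\<sigma> b) (\<sigma> x)"
proof -
  have "expresses n I W f e (fMul W f) (wmul n (2 ^ e))" for e
    unfolding fMul_def wmul_def by (intro expresses_fDistr expresses_fDistr' expresses_fSmul)
  then show ?thesis using assms by (simp add: expresses_def)
qed

section \<open>Triangular numbers and the theorem\<close>

definition "fPow2 m f W = fAll m (fIff (fBit W m) (Eq m f))"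
text \<open>The double exponential is expressed through \<open>D2\<close>: \<open>f + f\<close> has
  to be a bit position of a bit position.\<close>

definition "fSize m f = Ex m (Conj (fAdd (m+1) f f m) (Ex (m+1) (Ex (m+2) (Conj (fBit (m+1) m) (fBit (m+2) (m+1))))))"
definition "fSuc m x y = Conj (fLess m x y) (fAll m (Neg (Conj (fLess (m+1) x m) (fLess (m+1) m y))))"

primrec fConst :: "nat \<Rightarrow> nat \<Rightarrow> nat \<Rightarrow> sym_bit fo" where
  "fConst 0 m x = fZero m x"
| "fConst (Suc k) m x = Ex m (Conj (fConst k (m+1) m) (fSuc (m+1) m x))"

lemma wf_basic [simp]: "wf ar ar_bit (fPow2 m f W)" "wf ar ar_bit (fSize m f)" "wf ar ar_bit (fSuc m x y)"
  by (simp_all add: fPow2_def fSize_def fSuc_def)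

lemma wf_fConst [simp]: "wf ar ar_bit (fConst k m x)"
  by (induction k arbitrary: m x) simp_all

lemma sat_fPow2 [simp]:
  assumes "ok n \<sigma>" "f < m" "W < m"
  shows "satb n I (fPow2 m f W) \<sigma> \<longleftrightarrow> \<sigma> W = 2 ^ \<sigma> f"
proof -
  have "satb n I (fPow2 m f W) \<sigma> \<longleftrightarrow> (\<forall>i\<le>n. bit (\<sigma> W) i \<longleftrightarrow> bit (2 ^ \<sigma> f :: nat) i)"
    using assms by (auto simp: fPow2_def bit_exp_iff)
  also have "\<dots> \<longleftrightarrow> \<sigma> W = 2 ^ \<sigma> f"
  proof (rule nat_eq_bits_le)
    show "\<sigma> W < 2 ^ Suc n" using okD[OF assms(1), of W] by (intro le_imp_less_exp) linarith
    show "2 ^ \<sigma> f < (2::nat) ^ Suc n" using okD[OF assms(1), of f] by (intro power_strict_increasing) auto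
  qed
  finally show ?thesis .
qed

lemma sat_fSize [simp]:
  assumes "ok n \<sigma>" "f < m"
  shows "satb n I (fSize m f) \<sigma> \<longleftrightarrow> 2 ^ (2 ^ (\<sigma> f + \<sigma> f)) \<le> n"
proof -
  define g where "g = \<sigma> f + \<sigma> f"
  have "satb n I (fSize m f) \<sigma> \<longleftrightarrow> g \<le> n \<and> D2 n g"
    using assms by (auto simp: fSize_def D2_def g_def cong: conj_cong)
  also have "\<dots> \<longleftrightarrow> 2 ^ (2 ^ g) \<le> n" using D2I D2_exp D2_le by blast
  finally show ?thesis by (simp add: g_def)
qed

lemma sat_fSuc [simp]:
  assumes "ok n \<sigma>" "x < m" "y < m"
  shows "satb n I (fSuc m x y) \<sigma> \<longleftrightarrow> \<sigma> y = Suc (\<sigma> x)"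
proof -
  have "satb n I (fSuc m x y) \<sigma> \<longleftrightarrow> \<sigma> x < \<sigma> y \<and> (\<forall>z\<le>n. \<not> (\<sigma> x < z \<and> z < \<sigma> y))"
    using assms by (simp add: fSuc_def)
  also have "\<dots> \<longleftrightarrow> \<sigma> y = Suc (\<sigma> x)"
  proof
    assume *: "\<sigma> x < \<sigma> y \<and> (\<forall>z\<le>n. \<not> (\<sigma> x < z \<and> z < \<sigma> y))"
    then have "Suc (\<sigma> x) \<le> n" using okD[OF assms(1), of y] by linarith
    then have "\<not> (\<sigma> x < Suc (\<sigma> x) \<and> Suc (\<sigma> x) < \<sigma> y)" using * by blast
    then show "\<sigma> y = Suc (\<sigma> x)" using * by linarith
  qed auto
  finally show ?thesis .
qed

lemma sat_fConst [simp]: "ok n \<sigma> \<Longrightarrow> x < m \<Longrightarrow> satb n I (fConst k m x) \<sigma> \<longleftrightarrow> \<sigma> x = k"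
proof (induction k arbitrary: m x \<sigma>)
  case (Suc k)
  have "satb n I (fConst (Suc k) m x) \<sigma> \<longleftrightarrow> (\<exists>a\<le>n. a = k \<and> \<sigma> x = Suc a)"
  proof -
    have "satb n I (fConst k (m+1) m) (\<sigma>(m := a)) \<longleftrightarrow> a = k" if "a \<le> n" for a
      using Suc.IH[OF ok_upd[OF Suc.prems(1) that, of m] less_add_one[of m]] by (simp add: fun_upd_def)
    then show ?thesis using Suc.prems by (simp cong: conj_cong)
  qed
  also have "\<dots> \<longleftrightarrow> \<sigma> x = Suc k" using okD[OF Suc.prems(1), of x] by auto
  finally show ?case .
qed simp

primrec fSmallTri :: "nat \<Rightarrow> nat \<Rightarrow> nat \<Rightarrow> sym_bit fo" where
  "fSmallTri 0 m x = Neg (Eq x x)"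
| "fSmallTri (Suc k) m x = fOr (fSmallTri k m x) (if k \<in> range q then fConst k m x else Neg (Eq x x))"

lemma wf_fSmallTri [simp]: "wf ar ar_bit (fSmallTri k m x)"
  by (induction k) simp_all

lemma sat_fSmallTri [simp]:
  "ok n \<sigma> \<Longrightarrow> x < m \<Longrightarrow> satb n I (fSmallTri k m x) \<sigma> \<longleftrightarrow> \<sigma> x < k \<and> \<sigma> x \<in> range q"
  by (induction k) (auto simp: less_Suc_eq)

text \<open>For \<open>n \<ge> 2 ^ 256\<close> the window width is at least \<open>16\<close>, which leaves room for the convolution
  sums.\<close>

definition "fTri m x = fOr (fSmallTri (2 ^ 256) m x) (Ex m (Ex (m+1) (Conj (fPow2 (m+2) (m+1) m) (Conj (fSize (m+2) (m+1))
   (Ex (m+2) (Ex (m+3) (Conj (fMul m (m+1) (m+4) (m+2) (m+3) x)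
     (Ex (m+4) (Conj (fAdd (m+5) (m+2) (m+2) (m+4)) (fOr (fSuc (m+5) (m+4) (m+3)) (fSuc (m+5) (m+3) (m+4)))))))))))) "

lemma wf_fTri [simp]: "wf ar ar_bit (fTri m x)"
  by (simp add: fTri_def)

lemma q_even: "q (2 * a) = a * Suc (2 * a)"
  by (simp add: q_def)

lemma q_odd: "Suc b = 2 * a \<Longrightarrow> q b = a * b"
proof -
  assume b: "Suc b = 2 * a"
  have "b * (b + 1) = 2 * (a * b)" using b by simp
  then show ?thesis by (simp add: q_def)
qed

text \<open>The certificate disjunct accepts only triangular numbers for every \<open>n\<close>; it
  has to find a certificate only if \<open>\<sigma> x \<ge> 2 ^ 256\<close>, which forces
  \<open>n \<ge> 2 ^ 256\<close>.\<close>

lemma sat_fTri [simp]: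
  assumes "ok n \<sigma>" "x < m"
  shows "satb n I (fTri m x) \<sigma> \<longleftrightarrow> \<sigma> x \<in> range q"
proof -
  have "satb n I (fTri m x) \<sigma> \<longleftrightarrow> \<sigma> x < 2 ^ 256 \<and> \<sigma> x \<in> range q \<or>
    (\<exists>W\<le>n. \<exists>f\<le>n. W = 2 ^ f \<and> 2 ^ (2 ^ (f + f)) \<le> n \<and> (\<exists>a\<le>n. \<exists>b\<le>n. wmul n W a b (\<sigma> x) \<and>
      (\<exists>d\<le>n. d = a + a \<and> (b = Suc d \<or> d = Suc b))))" (is "_ \<longleftrightarrow> _ \<or> ?R")
    unfolding fTri_def using assms by (simp cong: conj_cong del: fSmallTri.simps)
  moreover have "\<sigma> x \<in> range q" if R: ?R
  proof -
    from R obtain f a b where h: "2 ^ (2 ^ (f + f)) \<le> n" "a \<le> n" "b \<le> n" "wmul n (2 ^ f) a b (\<sigma> x)"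
      "b = Suc (a + a) \<or> a + a = Suc b" by blast
    have "(2::nat) ^ f * 2 ^ f \<le> n" using h(1) less_exp[of "2 ^ (f + f)"] unfolding power_add by linarith
    from wmul_sound[OF _ this h(2,3) _ h(4)] have "\<sigma> x = a * b" using assms by simp
    then have "\<sigma> x = q (2 * a) \<or> \<sigma> x = q b" using h(5) q_even[of a] q_odd[of b a] by (auto simp: mult_2)
    then show ?thesis by blast
  qed
  moreover have ?R if x: "\<not> \<sigma> x < 2 ^ 256" "\<sigma> x \<in> range q"
  proof -
    from x(2) obtain c where c: "\<sigma> x = q c" by blast
    have n: "2 ^ 256 \<le> n" using x(1) okD[OF assms(1), of x] by linarith
    \<comment> \<open>Half of the even one among \<open>c\<close> and \<open>c + 1\<close> becomes
      \<open>a\<close> and the other one becomes \<open>b\<close>, so \<open>a \<le> b\<close>, as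
      \<open>wmul_complete\<close> requires.\<close>
    have "\<exists>a b. q c = a * b \<and> a \<le> b \<and> b \<le> Suc c \<and> a + a \<le> Suc c \<and> (b = Suc (a + a) \<or> a + a = Suc b)"
    proof (cases "even c")
      case True
      then obtain a where "c = 2 * a" by blast
      then show ?thesis using q_even[of a] by (intro exI[of _ a] exI[of _ "Suc (2 * a)"]) auto
    next
      case False
      then obtain a where a: "c = 2 * a + 1" by (metis oddE)
      then show ?thesis using q_odd[of c "Suc a"] by (intro exI[of _ "Suc a"] exI[of _ c]) auto
    qed
    then obtain a b where ab: "q c = a * b" "a \<le> b" "b \<le> Suc c" "a + a \<le> Suc c" "b = Suc (a + a) \<or> a + a = Suc b" by blast
    \<comment> \<open>From here \<open>Suc c \<le> q c \<le> n\<close>, which puts \<open>b\<close>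
      and \<open>a + a\<close> into the universe.\<close>
    have "c \<ge> 2"
    proof (rule ccontr)
      assume "\<not> c \<ge> 2"
      then have "c = 0 \<or> c = 1" by auto
      then have "q c \<le> 1" by (auto simp: q_def)
      then show False using x(1) c by simp
    qed
    then obtain c' where "c = Suc (Suc c')" by (metis add_2_eq_Suc le_Suc_ex)
    then have "Suc c \<le> q c" using q_ge[of "Suc c'"] by (simp add: q_Suc)
    then have cn: "Suc c \<le> n" using c okD[OF assms(1), of x] by linarith
    from wmul_complete[OF n] obtain f where f: "2 ^ (2 ^ (f + f)) \<le> n"
      "\<And>a b. a \<le> b \<Longrightarrow> b \<le> n \<Longrightarrow> a * b \<le> n \<Longrightarrow> wmul n (2 ^ f) a b (a * b)" by blast
    have "wmul n (2 ^ f) a b (\<sigma> x)"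
      using f(2)[of a b] ab cn okD[OF assms(1), of x] by (simp add: c)
    moreover have "(2::nat) ^ f \<le> 2 ^ (f + f)" by (intro power_increasing) auto
    then have "2 ^ f \<le> n" using f(1) less_exp[of "2 ^ (f + f)"] by linarith
    moreover have "f \<le> n" using \<open>2 ^ f \<le> n\<close> less_exp[of f] by linarith
    moreover have "a \<le> n" "b \<le> n" "a + a \<le> n" using ab cn by linarith+
    ultimately show ?thesis using f(1) ab(5) by blast
  qed
  ultimately show ?thesis by blast
qed

section \<open>Defining \<open>tri_less\<close> and translating formulas\<close>

definition "fFloor m x u = Conj (fTri m u) (Conj (Neg (fLess m x u))
   (fAll m (fImp (Conj (fTri (m+1) m) (Neg (fLess (m+1) x m))) (Neg (fLess (m+1) u m)))))"

text \<open>As \<open>q\<close> is strictly increasing, columns are compared through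
  \<open>q (cc x)\<close>; the variables \<open>m + 2\<close> and \<open>m + 3\<close> hold the
  rows.\<close>

definition "fTriLess m x y = Ex m (Ex (m+1) (Ex (m+2) (Ex (m+3) (Conj (fFloor (m+4) x m) (Conj (fFloor (m+4) y (m+1))
   (Conj (fAdd (m+4) m (m+2) x) (Conj (fAdd (m+4) (m+1) (m+3) y)
     (fOr (fLess (m+4) (m+2) (m+3)) (Conj (Eq (m+2) (m+3)) (fLess (m+4) m (m+1)))))))))))"

lemma wf_fTriLess [simp]: "wf ar ar_bit (fTriLess m x y)"
  by (simp add: fTriLess_def fFloor_def)

lemma sat_fFloor [simp]:
  assumes "ok n \<sigma>" "x < m" "u < m"
  shows "satb n I (fFloor m x u) \<sigma> \<longleftrightarrow> \<sigma> u = q (cc (\<sigma> x))"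
proof -
  have "satb n I (fFloor m x u) \<sigma> \<longleftrightarrow> \<sigma> u \<in> range q \<and> \<sigma> u \<le> \<sigma> x \<and>
     (\<forall>t\<le>n. t \<in> range q \<and> t \<le> \<sigma> x \<longrightarrow> t \<le> \<sigma> u)"
    using assms by (simp add: fFloor_def not_less)
  also have "\<dots> \<longleftrightarrow> \<sigma> u = q (cc (\<sigma> x))"
  proof
    assume *: "\<sigma> u \<in> range q \<and> \<sigma> u \<le> \<sigma> x \<and> (\<forall>t\<le>n. t \<in> range q \<and> t \<le> \<sigma> x \<longrightarrow> t \<le> \<sigma> u)"
    then obtain i where i: "\<sigma> u = q i" by blast
    have "q (cc (\<sigma> x)) \<le> n" using cc_bounds(1)[of "\<sigma> x"] okD[OF assms(1), of x] by linarith
    then have "q (cc (\<sigma> x)) \<le> \<sigma> u" using * cc_bounds(1)[of "\<sigma> x"] by blast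
    moreover have "q i < q (Suc (cc (\<sigma> x)))" using * i cc_bounds(2)[of "\<sigma> x"] by linarith
    then have "q i \<le> q (cc (\<sigma> x))"
      by (simp add: strict_mono_less[OF q_strict_mono] strict_mono_less_eq[OF q_strict_mono])
    ultimately show "\<sigma> u = q (cc (\<sigma> x))" using i by simp
  next
    assume u: "\<sigma> u = q (cc (\<sigma> x))"
    have "q i \<le> \<sigma> u" if "q i \<le> \<sigma> x" for i
    proof -
      have "q i < q (Suc (cc (\<sigma> x)))" using that cc_bounds(2)[of "\<sigma> x"] by linarith
      then show ?thesis unfolding u
        by (simp add: strict_mono_less[OF q_strict_mono] strict_mono_less_eq[OF q_strict_mono])
    qed
    then show "\<sigma> u \<in> range q \<and> \<sigma> u \<le> \<sigma> x \<and> (\<forall>t\<le>n. t \<in> range q \<and> t \<le> \<sigma> x \<longrightarrow> t \<le> \<sigma> u)"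
      using cc_bounds(1)[of "\<sigma> x"] u by auto
  qed
  finally show ?thesis .
qed

lemma sat_fTriLess [simp]:
  assumes "ok n \<sigma>" "x < m" "y < m"
  shows "satb n I (fTriLess m x y) \<sigma> \<longleftrightarrow> tri_less (\<sigma> x) (\<sigma> y)"
proof -
  have "satb n I (fTriLess m x y) \<sigma> \<longleftrightarrow> (\<exists>u\<le>n. \<exists>v\<le>n. \<exists>r\<le>n. \<exists>s\<le>n. u = q (cc (\<sigma> x)) \<and> v = q (cc (\<sigma> y)) \<and>
     \<sigma> x = u + r \<and> \<sigma> y = v + s \<and> (r < s \<or> r = s \<and> u < v))"
    using assms by (simp add: fTriLess_def cong: conj_cong)
  also have "\<dots> \<longleftrightarrow> tri_less (\<sigma> x) (\<sigma> y)"
  proof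
    assume "\<exists>u\<le>n. \<exists>v\<le>n. \<exists>r\<le>n. \<exists>s\<le>n. u = q (cc (\<sigma> x)) \<and> v = q (cc (\<sigma> y)) \<and>
     \<sigma> x = u + r \<and> \<sigma> y = v + s \<and> (r < s \<or> r = s \<and> u < v)"
    then obtain u v r s where h: "u = q (cc (\<sigma> x))" "v = q (cc (\<sigma> y))"
      "\<sigma> x = u + r" "\<sigma> y = v + s" "r < s \<or> r = s \<and> u < v" by blast
    then have "r = rr (\<sigma> x)" "s = rr (\<sigma> y)" by (simp_all add: rr_def)
    then show "tri_less (\<sigma> x) (\<sigma> y)"
      using h(5) by (auto simp: tri_less_def h(1,2) strict_mono_less[OF q_strict_mono])
  next
    assume t: "tri_less (\<sigma> x) (\<sigma> y)"
    have "q (cc (\<sigma> v)) \<le> n \<and> rr (\<sigma> v) \<le> n" for v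
      using eq_q_plus_rr[of "\<sigma> v"] okD[OF assms(1), of v] by linarith
    then show "\<exists>u\<le>n. \<exists>v\<le>n. \<exists>r\<le>n. \<exists>s\<le>n. u = q (cc (\<sigma> x)) \<and> v = q (cc (\<sigma> y)) \<and>
     \<sigma> x = u + r \<and> \<sigma> y = v + s \<and> (r < s \<or> r = s \<and> u < v)"
      using t eq_q_plus_rr[of "\<sigma> x"] eq_q_plus_rr[of "\<sigma> y"] strict_mono_less[OF q_strict_mono]
      unfolding tri_less_def by blast
  qed
  finally show ?thesis .
qed

text \<open>\<open>Suc (x + y)\<close> exceeds both variables, as the convention on bound variables
  demands. For well-formed atoms \<open>xs\<close> is a list of length 2.\<close>

fun to_bit :: "sym_lt_tri fo \<Rightarrow> sym_bit fo" where
  "to_bit (Eq x y) = Eq x y"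
| "to_bit (Rel R xs) = Rel R xs"
| "to_bit (Num LessSym xs) = (let x = xs ! 0; y = xs ! 1 in fLess (Suc (x + y)) x y)"
| "to_bit (Num TriSym xs) = (let x = xs ! 0; y = xs ! 1 in fTriLess (Suc (x + y)) x y)"
| "to_bit (Neg \<phi>) = Neg (to_bit \<phi>)"
| "to_bit (Conj \<phi> \<psi>) = Conj (to_bit \<phi>) (to_bit \<psi>)"
| "to_bit (Ex x \<phi>) = Ex x (to_bit \<phi>)"

lemma wf_to_bit: "wf ar ar_lt_tri \<phi> \<Longrightarrow> wf ar ar_bit (to_bit \<phi>)"
  by (induction \<phi> rule: to_bit.induct) (simp_all add: Let_def)

lemma sat_to_bit:
  "wf ar ar_lt_tri \<phi> \<Longrightarrow> ok n \<sigma> \<Longrightarrow> satb n I (to_bit \<phi>) \<sigma> \<longleftrightarrow> sat pred_lt_tri n I \<phi> \<sigma>"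
proof (induction \<phi> arbitrary: \<sigma> rule: to_bit.induct)
  case (3 xs)
  then obtain x y where "xs = [x, y]" by (auto simp: ar_lt_tri_def length_Suc_conv numeral_2_eq_2)
  then show ?case using 3 by (simp add: Let_def)
next
  case (4 xs)
  then obtain x y where "xs = [x, y]" by (auto simp: ar_lt_tri_def length_Suc_conv numeral_2_eq_2)
  then show ?case using 4 by (simp add: Let_def)
next
  case (7 x \<phi>)
  then show ?case by (simp cong: conj_cong)
qed simp_all

section \<open>Separation by parity\<close>

text \<open>A sentence that reads bit 0 of the last element, which is \<open>n\<close>.\<close>

definition fOdd :: "sym_bit fo" where
  "fOdd = Ex 0 (Conj (fAll 1 (Neg (fLess 2 0 1))) (Ex 1 (Conj (fZero 2 1) (fBit 0 1))))"

lemma wf_fOdd: "wf ar ar_bit fOdd"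
  by (simp add: fOdd_def)

lemma sat_fOdd: "ok n \<sigma> \<Longrightarrow> satb n I fOdd \<sigma> \<longleftrightarrow> odd n"
proof -
  assume ok: "ok n \<sigma>"
  have "satb n I fOdd \<sigma> \<longleftrightarrow> (\<exists>z\<le>n. (\<forall>y\<le>n. \<not> z < y) \<and> (\<exists>i\<le>n. i = 0 \<and> bit z i))"
    using ok by (simp add: fOdd_def cong: conj_cong)
  also have "\<dots> \<longleftrightarrow> (\<exists>z. z = n \<and> odd z)"
    by (rule ex_cong1) (auto simp: bit_0 not_less intro: le_antisym)
  finally show ?thesis by simp
qed

theorem theorem4p1:
  shows "(\<forall>ar (\<phi> :: sym_lt_tri fo). wf ar ar_lt_tri \<phi> \<longrightarrow>
            (\<exists>\<psi> :: sym_bit fo. wf ar ar_bit \<psi> \<and> equiv_fo ar pred_lt_tri \<phi> pred_bit \<psi>))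
       \<and> (\<exists>ar (\<psi> :: sym_bit fo). wf ar ar_bit \<psi> \<and>
            \<not> (\<exists>\<phi> :: sym_lt_tri fo. wf ar ar_lt_tri \<phi> \<and> equiv_fo ar pred_lt_tri \<phi> pred_bit \<psi>))"
proof (intro conjI allI impI)
  fix ar and \<phi> :: "sym_lt_tri fo" assume "wf ar ar_lt_tri \<phi>"
  then show "\<exists>\<psi> :: sym_bit fo. wf ar ar_bit \<psi> \<and> equiv_fo ar pred_lt_tri \<phi> pred_bit \<psi>"
    by (intro exI[of _ "to_bit \<phi>"]) (simp add: wf_to_bit equiv_fo_def sat_to_bit ok_def)
next
  \<comment> \<open>Parity concerns the bare universe, so all relations may be taken empty, with
    arity 0.\<close>
  have "\<not> equiv_fo (\<lambda>_. 0) pred_lt_tri \<phi> pred_bit fOdd" for \<phi>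
  proof
    assume e: "equiv_fo (\<lambda>_. 0) pred_lt_tri \<phi> pred_bit fOdd"
    have "sat pred_lt_tri n (\<lambda>_. {}) \<phi> (\<lambda>_. 0) = odd n" for n
    proof -
      have "sat pred_lt_tri n (\<lambda>_. {}) \<phi> (\<lambda>_. 0) = satb n (\<lambda>_. {}) fOdd (\<lambda>_. 0)"
        using e by (simp add: equiv_fo_def is_struct_def)
      then show ?thesis by (simp add: sat_fOdd ok_def)
    qed
    then show False using parity_not_definable[of \<phi>] by blast
  qed
  then show "\<exists>ar (\<psi> :: sym_bit fo). wf ar ar_bit \<psi> \<and>
      \<not> (\<exists>\<phi> :: sym_lt_tri fo. wf ar ar_lt_tri \<phi> \<and> equiv_fo ar pred_lt_tri \<phi> pred_bit \<psi>)"
    using wf_fOdd by blast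
qed

end
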